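(* Let $A\in\mathbb{R}^{n\times n}$ be Metzler and let $E\in\mathbb{R}^{n\times q}$, $C\in\mathbb{R}^{q\times n}$, $F\in\mathbb{R}^{q\times q}$ be entrywise nonnegative (so that $(A,E,C,F)$ is internally positive). Let $q=q_1+\dots+q_N$ and $$\boldsymbol{\Delta}^{1}:=\{\Delta=\mathrm{diag}(\Delta_1,\ldots,\Delta_N):\ \Delta_i\in\mathbb{C}^{q_i\times q_i},\ \|\Delta_i\|_1\le 1\},\qquad \mathcal{D}_\Delta:=\{\mathrm{diag}(d_1I_{q_1},\ldots,d_NI_{q_N}):\ d_i>0\}.$$ Consider the uncertain system $\dot x=Ax+Ew$, $z=Cx+Fw$, $w=\Delta z$. The following statements are equivalent: (i) The uncertain system is asymptotically stable for all $\Delta\in\boldsymbol{\Delta}^{1}$. (ii) There exist a vector $\lambda\in\mathbb{R}^n_{>0}$ and a matrix $D\in\mathcal{D}_\Delta$ such that $$\begin{bmatrix}\lambda\\ D\mathbf{1}_q\end{bmatrix}^T\begin{bmatrix}A & E\\ C & F-I_q\end{bmatrix}<0 .$$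
   Context: A real matrix is Metzler if all its off-diagonal entries are nonnegative. $\|\cdot\|_1$ is the matrix norm induced by the vector 1-norm. $\mathbf{1}_q$ is the $q$-dimensional vector of ones. Vector inequalities are componentwise. The uncertain system is asymptotically stable for a given $\Delta$ if the interconnection is well posed ($I-F\Delta$ invertible) and the closed-loop matrix $A+E\Delta(I-F\Delta)^{-1}C$ is Hurwitz stable. *)

theory Defs
  imports "Jordan_Normal_Form.Gauss_Jordan_Elimination" "Jordan_Normal_Form.Char_Poly"
begin

definition cmat :: "real mat \<Rightarrow> complex mat" where
  "cmat M = map_mat complex_of_real M"

definition metzler :: "real mat \<Rightarrow> bool" where
  "metzler A \<longleftrightarrow> (\<forall>i < dim_row A. \<forall>j < dim_col A. i \<noteq> j \<longrightarrow> A $$ (i,j) \<ge> 0)"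

definition nonneg_mat :: "real mat \<Rightarrow> bool" where
  "nonneg_mat M \<longleftrightarrow> (\<forall>i < dim_row M. \<forall>j < dim_col M. M $$ (i,j) \<ge> 0)"

definition hurwitz :: "complex mat \<Rightarrow> bool" where
  "hurwitz M \<longleftrightarrow> (\<forall>ev. eigenvalue M ev \<longrightarrow> Re ev < 0)"

(* asymptotic stability of the interconnection for a given Delta:
   well-posedness (I - F Delta invertible) and the closed-loop matrix
   A + E Delta (I - F Delta)^{-1} C is Hurwitz *)
definition stable_for :: "real mat \<Rightarrow> real mat \<Rightarrow> real mat \<Rightarrow> real mat \<Rightarrow> complex mat \<Rightarrow> bool" where
  "stable_for A E C F \<Delta> \<longleftrightarrow>
     (let q = dim_row F in
      case mat_inverse (1\<^sub>m q - cmat F * \<Delta>) of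
        None \<Rightarrow> False
      | Some B \<Rightarrow> hurwitz (cmat A + cmat E * \<Delta> * B * cmat C))"

definition ones_vec :: "nat \<Rightarrow> real vec" where
  "ones_vec q = vec q (\<lambda>_. 1)"

definition vnorm1 :: "complex vec \<Rightarrow> real" where
  "vnorm1 x = (\<Sum>i<dim_vec x. cmod (x $ i))"

definition mnorm1 :: "complex mat \<Rightarrow> real" where
  "mnorm1 M = (SUP x \<in> {x. dim_vec x = dim_col M \<and> x \<noteq> 0\<^sub>v (dim_col M)}. vnorm1 (M *\<^sub>v x) / vnorm1 x)"

(* block structure given by the list of block sizes qs = [q_1,...,q_N] *)
definition blk_off :: "nat list \<Rightarrow> nat \<Rightarrow> nat" where
  "blk_off qs i = sum_list (take i qs)"

definition blk_of :: "nat list \<Rightarrow> nat \<Rightarrow> nat" where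
  "blk_of qs k = (THE i. i < length qs \<and> blk_off qs i \<le> k \<and> k < blk_off qs (Suc i))"

definition diag_block :: "nat list \<Rightarrow> complex mat \<Rightarrow> nat \<Rightarrow> complex mat" where
  "diag_block qs \<Delta> i = mat (qs ! i) (qs ! i) (\<lambda>(a,b). \<Delta> $$ (blk_off qs i + a, blk_off qs i + b))"

definition Delta1 :: "nat list \<Rightarrow> complex mat set" where
  "Delta1 qs = {\<Delta>. \<Delta> \<in> carrier_mat (sum_list qs) (sum_list qs)
      \<and> (\<forall>j < sum_list qs. \<forall>k < sum_list qs. blk_of qs j \<noteq> blk_of qs k \<longrightarrow> \<Delta> $$ (j,k) = 0)
      \<and> (\<forall>i < length qs. mnorm1 (diag_block qs \<Delta> i) \<le> 1)}"

definition DDelta :: "nat list \<Rightarrow> real mat set" where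
  "DDelta qs = {mat (sum_list qs) (sum_list qs) (\<lambda>(j,k). if j = k then d (blk_of qs j) else 0)
      | d. \<forall>i < length qs. d i > 0}"

end

theory Submission
  imports Defs
begin

text \<open>
  If the vector inequality holds, its left-hand side pairs strictly negatively with the moduli of
  any solution of \<open>s x = A x + E w\<close>, \<open>z = C x + F w\<close>, \<open>w = \<Delta> z\<close>, \<open>Re s \<ge> 0\<close>, while the Metzler
  structure and \<open>\<parallel>\<Delta>\<^sub>i\<parallel> \<le> 1\<close> make the same pairing nonnegative; hence \<open>x = 0\<close> and \<open>w = 0\<close>.

  Conversely, if the inequality is infeasible, a theorem of the alternative yields nonnegative
  \<open>x, w\<close>, not both zero, with \<open>A x + E w \<ge> 0\<close> such that the entries of \<open>z = C x + F w\<close> have in each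
  block at least the sum of those of \<open>w\<close>. A nonnegative \<open>\<Delta>\<close> of rank one in each block, of norm at
  most 1, maps \<open>z\<close> to \<open>w\<close>. Were all \<open>t \<Delta>\<close> with \<open>0 \<le> t \<le> 1\<close> stable, the Z-matrices of the equations
  above with \<open>(s, t)\<close> moving from \<open>(\<kappa>, 0)\<close> to \<open>(0, 1)\<close> would all be nonsingular, so the last one
  would be inverse-positive; this forces \<open>x, z \<le> 0\<close>, hence \<open>x = 0\<close>, \<open>z = 0\<close> and \<open>w = 0\<close>. No
  Perron--Frobenius theorem is needed.
\<close>

subsection \<open>Theorem of the alternative\<close>

text \<open>The convex cone generated by \<open>S\<close>, without adjoining the zero vector: every
  member is a nonempty combination with positive coefficients. This nontriviality makes a member
  that vanishes on \<open>J\<close> an obstruction to solvability.\<close>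

inductive_set pos_hull :: "('v \<Rightarrow> real) set \<Rightarrow> ('v \<Rightarrow> real) set" for S where
  base: "a \<in> S \<Longrightarrow> a \<in> pos_hull S"
| add: "a \<in> pos_hull S \<Longrightarrow> b \<in> pos_hull S \<Longrightarrow> (\<lambda>j. a j + b j) \<in> pos_hull S"
| scale: "a \<in> pos_hull S \<Longrightarrow> c > 0 \<Longrightarrow> (\<lambda>j. c * a j) \<in> pos_hull S"

lemma pos_hull_least:
  assumes "b \<in> pos_hull T" "T \<subseteq> pos_hull S"
  shows "b \<in> pos_hull S"
  using assms by (induction rule: pos_hull.induct) (auto intro: pos_hull.intros)

lemma pos_hull_coord_zero:
  assumes "b \<in> pos_hull T" "\<And>a. a \<in> T \<Longrightarrow> a k = 0"
  shows "b k = 0"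
  using assms by (induction rule: pos_hull.induct) auto

text \<open>Supplies the value of an eliminated variable from finitely many strict lower and upper
  bounds. An empty side is treated separately, as it has no \<open>Max\<close> or
  \<open>Min\<close>.\<close>

lemma real_between_finite:
  fixes L U :: "real set"
  assumes "finite L" "finite U" "\<And>l u. l \<in> L \<Longrightarrow> u \<in> U \<Longrightarrow> l < u"
  shows "\<exists>t. (\<forall>l\<in>L. l < t) \<and> (\<forall>u\<in>U. t < u)"
proof -
  consider "L = {}" | "U = {}" | "L \<noteq> {}" "U \<noteq> {}" by blast
  then show ?thesis
  proof cases
    case 1
    have "Min U - 1 < u" if "u \<in> U" for u using Min_le[OF assms(2) that] by simp
    with 1 show ?thesis by blast
  next
    case 2
    have "l < Max L + 1" if "l \<in> L" for l using Max_ge[OF assms(1) that] by simp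
    with 2 show ?thesis by blast
  next
    case 3
    then have "Max L < Min U" using assms by simp
    then obtain t where "Max L < t" "t < Min U" using dense by blast
    then show ?thesis using assms(1,2) 3 by auto
  qed
qed

text \<open>Fourier--Motzkin elimination of one variable at a time.\<close>
lemma gordan:
  assumes "finite J" "finite S"
  shows "(\<exists>x. \<forall>a\<in>S. (\<Sum>j\<in>J. a j * x j) < 0) \<or> (\<exists>b\<in>pos_hull S. \<forall>j\<in>J. b j = 0)"
  using assms
proof (induction J arbitrary: S rule: finite_induct)
  \<comment> \<open>Over no coordinates every sum is 0: the strict inequalities hold only for
    \<open>S = {}\<close>, and otherwise any member of \<open>S\<close> is a certificate.\<close>
  case empty
  show ?case by (cases "S = {}") (auto intro: pos_hull.base)
next
  case (insert k J)
  define Z where "Z = {a\<in>S. a k = 0}"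
  define P where "P = {a\<in>S. a k > 0}"
  define N where "N = {a\<in>S. a k < 0}"
  \<comment> \<open>The weights \<open>- n k\<close> and \<open>p k\<close> are positive and cancel
    coordinate \<open>k\<close>, so the new rows stay in the hull and vanish at
    \<open>k\<close>.\<close>
  define mix where "mix p n = (\<lambda>j. (- n k) * p j + p k * n j)" for p n :: "'a \<Rightarrow> real"
  define T where "T = Z \<union> (\<lambda>(p,n). mix p n) ` (P \<times> N)"
  have fin: "finite P" "finite N" "finite T"
    using insert.prems by (auto simp: Z_def P_def N_def T_def)
  have sub: "T \<subseteq> pos_hull S"
  proof
    fix a assume "a \<in> T"
    then consider "a \<in> S" | p n where "p \<in> P" "n \<in> N" "a = mix p n"
      by (auto simp: T_def Z_def)
    then show "a \<in> pos_hull S"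
    proof cases
      case 1 then show ?thesis by (rule pos_hull.base)
    next
      case 2
      then show ?thesis unfolding 2(3) mix_def
        by (intro pos_hull.add pos_hull.scale pos_hull.base) (auto simp: P_def N_def)
    qed
  qed
  have zero: "a k = 0" if "a \<in> T" for a
    using that by (auto simp: T_def Z_def mix_def)
  from insert.IH[OF fin(3)] show ?case
  proof
    assume "\<exists>b\<in>pos_hull T. \<forall>j\<in>J. b j = 0"
    then obtain b where b: "b \<in> pos_hull T" "\<forall>j\<in>J. b j = 0" by blast
    have "b k = 0" using b(1) zero by (rule pos_hull_coord_zero)
    then show ?thesis using pos_hull_least[OF b(1) sub] b(2) by auto
  next
    assume "\<exists>x. \<forall>a\<in>T. (\<Sum>j\<in>J. a j * x j) < 0"
    then obtain x where x: "\<And>a. a \<in> T \<Longrightarrow> (\<Sum>j\<in>J. a j * x j) < 0" by blast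
    define s where "s a = (\<Sum>j\<in>J. a j * x j)" for a
    \<comment> \<open>The inequality of the mixed row, divided by the positive
      \<open>p k * (- n k)\<close>: each lower bound on the value at \<open>k\<close> lies below
      each upper bound.\<close>
    have between: "s n / (- n k) < - s p / p k" if "p \<in> P" "n \<in> N" for p n
    proof -
      have "mix p n \<in> T" using that by (auto simp: T_def)
      from x[OF this] have "(- n k) * s p + p k * s n < 0"
        by (simp add: mix_def s_def sum_distrib_left distrib_right sum.distrib mult.assoc
            del: mult_minus_left)
      moreover have "p k > 0" "- n k > 0" using that by (auto simp: P_def N_def)
      ultimately show ?thesis by (simp add: field_simps)
    qed
    have "\<exists>t. (\<forall>l\<in>(\<lambda>n. s n / (- n k)) ` N. l < t) \<and> (\<forall>u\<in>(\<lambda>p. - s p / p k) ` P. t < u)"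
      by (rule real_between_finite) (use fin between in auto)
    then obtain t where t: "\<And>n. n \<in> N \<Longrightarrow> s n / (- n k) < t" "\<And>p. p \<in> P \<Longrightarrow> t < - s p / p k"
      by (metis imageI)
    have "(\<Sum>j\<in>insert k J. a j * (x(k := t)) j) < 0" if "a \<in> S" for a
    proof -
      have "(\<Sum>j\<in>insert k J. a j * (x(k := t)) j) = a k * t + s a"
        using insert.hyps by (auto simp: s_def intro!: sum.cong)
      moreover have "a k * t + s a < 0"
      proof (cases "a k" "0 :: real" rule: linorder_cases)
        case less
        then show ?thesis using t(1)[of a] that by (simp add: N_def field_simps)
      next
        case equal
        then show ?thesis using x[of a] that by (simp add: T_def Z_def s_def)
      next
        case greater
        then show ?thesis using t(2)[of a] that by (simp add: P_def field_simps)
      qed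
      ultimately show ?thesis by simp
    qed
    then show ?thesis by blast
  qed
qed

text \<open>Recovers multipliers from a hull member: \<open>p\<close> belongs to the rows
  \<open>g i\<close>, \<open>s\<close> to the rows that encode \<open>x j > 0\<close> as
  \<open>- x j < 0\<close>.\<close>

lemma pos_hull_rows:
  assumes "b \<in> pos_hull (g ` I \<union> (\<lambda>j i. if i = j then -1 else 0) ` J)" "finite I" "finite J"
  shows "\<exists>p s. (\<forall>i\<in>I. p i \<ge> 0) \<and> (\<forall>j\<in>J. s j \<ge> 0) \<and> ((\<exists>i\<in>I. p i > 0) \<or> (\<exists>j\<in>J. s j > 0)) \<and>
           (\<forall>j\<in>J. b j = (\<Sum>i\<in>I. p i * g i j) - s (j::'v))"
  using assms
proof (induction rule: pos_hull.induct)
  case (base a)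
  then consider i where "i \<in> I" "a = g i" | j where "j \<in> J" "a = (\<lambda>i. if i = j then -1 else 0)"
    by blast
  then show ?case
  proof cases
    case 1
    then show ?thesis using base.prems
      by (intro exI[of _ "\<lambda>k. if k = i then 1 else 0"] exI[of _ "\<lambda>_. 0"])
         (auto simp: if_distrib[of "\<lambda>x. x * _"] cong: if_cong)
  next
    case 2
    then show ?thesis
      by (intro exI[of _ "\<lambda>_. 0"] exI[of _ "\<lambda>k. if k = j then 1 else 0"]) auto
  qed
next
  case (add a b)
  then obtain p s p' s' where
    p: "\<forall>i\<in>I. p i \<ge> 0" "\<forall>j\<in>J. s j \<ge> 0" "(\<exists>i\<in>I. p i > 0) \<or> (\<exists>j\<in>J. s j > 0)"
       "\<forall>j\<in>J. a j = (\<Sum>i\<in>I. p i * g i j) - s j" and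
    p': "\<forall>i\<in>I. p' i \<ge> 0" "\<forall>j\<in>J. s' j \<ge> 0"
       "\<forall>j\<in>J. b j = (\<Sum>i\<in>I. p' i * g i j) - s' j"
    by blast
  have "(\<exists>i\<in>I. p i + p' i > 0) \<or> (\<exists>j\<in>J. s j + s' j > 0)"
    using p p' by (meson add_pos_nonneg)
  moreover have "a j + b j = (\<Sum>i\<in>I. (p i + p' i) * g i j) - (s j + s' j)" if "j \<in> J" for j
    using p(4) p'(3) that by (simp add: distrib_right sum.distrib)
  ultimately show ?case
    using p(1,2) p'(1,2) by (intro exI[of _ "\<lambda>i. p i + p' i"] exI[of _ "\<lambda>j. s j + s' j"]) auto
next
  case (scale a c)
  then obtain p s where
    p: "\<forall>i\<in>I. p i \<ge> 0" "\<forall>j\<in>J. s j \<ge> 0" "(\<exists>i\<in>I. p i > 0) \<or> (\<exists>j\<in>J. s j > 0)"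
       "\<forall>j\<in>J. a j = (\<Sum>i\<in>I. p i * g i j) - s j"
    by blast
  have "(\<exists>i\<in>I. c * p i > 0) \<or> (\<exists>j\<in>J. c * s j > 0)"
    using p(3) scale.hyps by (meson mult_pos_pos)
  moreover have "c * a j = (\<Sum>i\<in>I. (c * p i) * g i j) - c * s j" if "j \<in> J" for j
    using p(4) that by (simp add: right_diff_distrib sum_distrib_left mult.assoc)
  ultimately show ?case
    using p(1,2) scale.hyps by (intro exI[of _ "\<lambda>i. c * p i"] exI[of _ "\<lambda>j. c * s j"]) auto
qed

text \<open>Positivity of the unknowns is adjoined as extra strict rows. In a certificate their
  multipliers \<open>s\<close> are slack, so the combination of the rows \<open>g i\<close> equals
  \<open>s \<ge> 0\<close>; and \<open>p = 0\<close> would force \<open>s = 0\<close>, which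
  nontriviality excludes.\<close>

lemma positive_alternative:
  fixes g :: "'r \<Rightarrow> 'v \<Rightarrow> real"
  assumes "finite I" "finite J"
    and no: "\<nexists>x. (\<forall>j\<in>J. x j > 0) \<and> (\<forall>i\<in>I. (\<Sum>j\<in>J. g i j * x j) < 0)"
  obtains p where "\<And>i. i \<in> I \<Longrightarrow> p i \<ge> 0" "\<exists>i\<in>I. p i > 0" "\<And>j. j \<in> J \<Longrightarrow> (\<Sum>i\<in>I. p i * g i j) \<ge> 0"
proof -
  define S where "S = g ` I \<union> (\<lambda>j i. if i = j then -1 else 0) ` J"
  have "finite S" using assms by (simp add: S_def)
  from gordan[OF assms(2) this] show thesis
  proof
    assume "\<exists>x. \<forall>a\<in>S. (\<Sum>j\<in>J. a j * x j) < 0"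
    then obtain x where x: "\<And>a. a \<in> S \<Longrightarrow> (\<Sum>j\<in>J. a j * x j) < 0" by blast
    have "x j > 0" if "j \<in> J" for j
      using x[of "\<lambda>i. if i = j then -1 else 0"] that assms(2)
      by (simp add: S_def if_distrib[of "\<lambda>y. y * _"] cong: if_cong)
    moreover have "(\<Sum>j\<in>J. g i j * x j) < 0" if "i \<in> I" for i
      using x[of "g i"] that by (simp add: S_def)
    ultimately show thesis using no by blast
  next
    assume "\<exists>b\<in>pos_hull S. \<forall>j\<in>J. b j = 0"
    then obtain b where b: "b \<in> pos_hull S" "\<And>j. j \<in> J \<Longrightarrow> b j = 0" by blast
    from pos_hull_rows[OF b(1)[unfolded S_def] assms(1,2)] obtain p s where
      p: "\<forall>i\<in>I. p i \<ge> 0" "\<forall>j\<in>J. s j \<ge> 0" "(\<exists>i\<in>I. p i > 0) \<or> (\<exists>j\<in>J. s j > 0)"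
       "\<forall>j\<in>J. b j = (\<Sum>i\<in>I. p i * g i j) - s j" by blast
    have eq: "(\<Sum>i\<in>I. p i * g i j) = s j" if "j \<in> J" for j using p(4) b(2) that by simp
    have "\<exists>i\<in>I. p i > 0"
    proof (rule ccontr)
      assume *: "\<not> ?thesis"
      then have "\<forall>i\<in>I. p i = 0" using p(1) by force
      then have "\<forall>j\<in>J. s j = 0" using eq by fastforce
      then show False using * p(3) by auto
    qed
    then show thesis using that[of p] p eq by auto
  qed
qed

subsection \<open>Paths of Z-matrices\<close>

lemma continuous_on_det:
  fixes M :: "real \<Rightarrow> real mat"
  assumes "\<And>t. M t \<in> carrier_mat m m"
    and "\<And>i j. i < m \<Longrightarrow> j < m \<Longrightarrow> continuous_on T (\<lambda>t. M t $$ (i,j))"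
  shows "continuous_on T (\<lambda>t. det (M t))"
proof -
  have "p i < m" if "p permutes {0..<m}" "i < m" for p i
    using that permutes_in_image[OF that(1), of i] by simp
  then show ?thesis
    unfolding det_def'[OF assms(1)] by (intro continuous_intros assms(2)) auto
qed

lemma continuous_on_adj_mat:
  fixes M :: "real \<Rightarrow> real mat"
  assumes M: "\<And>t. M t \<in> carrier_mat m m"
    and cont: "\<And>i j. i < m \<Longrightarrow> j < m \<Longrightarrow> continuous_on T (\<lambda>t. M t $$ (i,j))"
    and ij: "i < m" "j < m"
  shows "continuous_on T (\<lambda>t. adj_mat (M t) $$ (i,j))"
proof -
  have dim: "dim_row (M t) = m" "dim_col (M t) = m" for t using M by auto
  have "continuous_on T (\<lambda>t. mat_delete (M t) j i $$ (a,b))" if "a < m - 1" "b < m - 1" for a b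
  proof -
    \<comment> \<open>The minor skips row \<open>j\<close> and column \<open>i\<close>, so later
      indices shift up by one and still stay below \<open>m\<close>.\<close>
    have "(if a < j then a else Suc a) < m" "(if b < i then b else Suc b) < m" using that by auto
    from cont[OF this] show ?thesis using that by (simp add: mat_delete_def dim)
  qed
  then have "continuous_on T (\<lambda>t. det (mat_delete (M t) j i))"
    by (intro continuous_on_det[of _ "m - 1"]) (auto simp: mat_delete_def dim)
  then show ?thesis
    using ij by (simp add: adj_mat_def dim cofactor_def) (intro continuous_intros)
qed

lemma continuous_on_Min:
  fixes f :: "'i \<Rightarrow> real \<Rightarrow> real"
  assumes "finite I" "I \<noteq> {}" "\<And>i. i \<in> I \<Longrightarrow> continuous_on T (f i)"
  shows "continuous_on T (\<lambda>t. Min ((\<lambda>i. f i t) ` I))"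
  using assms
proof (induction rule: finite_ne_induct)
  case (insert i I)
  then show ?case by (auto intro: continuous_on_min)
qed auto

lemma mult_mat_vec_sum:
  assumes "M \<in> carrier_mat k l" "x \<in> carrier_vec l" "i < k"
  shows "(M *\<^sub>v x) $ i = (\<Sum>j<l. M $$ (i,j) * x $ j)"
  using assms by (auto simp: scalar_prod_def atLeast0LessThan)

text \<open>Let \<open>c\<close> be the largest ratio \<open>u $ i / y $ i\<close> and suppose
  \<open>c > 0\<close>. The vector \<open>c y - u\<close> is nonnegative and zero in the maximizing
  entry, so the off-diagonal signs make that row of \<open>M (c y - u)\<close> nonpositive, against
  \<open>M y > 0\<close> and \<open>M u \<le> 0\<close>.\<close>

lemma Z_matrix_nonpos:
  fixes M :: "real mat"
  assumes M: "M \<in> carrier_mat m m" and y: "y \<in> carrier_vec m" and u: "u \<in> carrier_vec m"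
    and Z: "\<And>i j. i < m \<Longrightarrow> j < m \<Longrightarrow> i \<noteq> j \<Longrightarrow> M $$ (i,j) \<le> 0"
    and ypos: "\<And>i. i < m \<Longrightarrow> y $ i > 0" and My: "\<And>i. i < m \<Longrightarrow> (M *\<^sub>v y) $ i > 0"
    and Mu: "\<And>i. i < m \<Longrightarrow> (M *\<^sub>v u) $ i \<le> 0"
    and k: "k < m"
  shows "u $ k \<le> 0"
proof (rule ccontr)
  assume k_pos: "\<not> ?thesis"
  define r where "r i = u $ i / y $ i" for i
  define c where "c = Max (r ` {..<m})"
  have r_le: "r i \<le> c" if "i < m" for i using that by (simp add: c_def)
  have "0 < r k" using k_pos ypos[OF k] by (simp add: r_def)
  then have c: "c > 0" using r_le[OF k] by simp
  have "c \<in> r ` {..<m}" unfolding c_def by (rule Max_in) (use k in auto)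
  then obtain i where i: "i < m" "c = r i" by auto
  have "c * (M *\<^sub>v y) $ i = (\<Sum>j<m. M $$ (i,j) * (c * y $ j))"
    using i by (simp add: mult_mat_vec_sum[OF M y] sum_distrib_left ac_simps)
  also have "\<dots> \<le> (\<Sum>j<m. M $$ (i,j) * u $ j)"
  proof (rule sum_mono)
    fix j assume j: "j \<in> {..<m}"
    show "M $$ (i,j) * (c * y $ j) \<le> M $$ (i,j) * u $ j"
    proof (cases "j = i")
      case True
      then show ?thesis using ypos[of i] i by (simp add: r_def)
    next
      case False
      have "u $ j \<le> c * y $ j" using r_le[of j] ypos[of j] j by (simp add: r_def field_simps)
      then show ?thesis using Z[of i j] False i j by (intro mult_left_mono_neg) auto
    qed
  qed
  also have "\<dots> = (M *\<^sub>v u) $ i" using i by (simp add: mult_mat_vec_sum[OF M u])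
  finally show False using c My[OF i(1)] Mu[OF i(1)] mult_pos_pos[of c "(M *\<^sub>v y) $ i"] by linarith
qed

text \<open>The solution of \<open>M t y = M 0 v\<close> starts at \<open>v > 0\<close> and moves continuously; when its smallest
  entry first vanishes, the Z-matrix sign pattern makes that entry of the right-hand side
  nonpositive, a contradiction.\<close>
lemma Z_matrix_path:
  fixes M :: "real \<Rightarrow> real mat"
  assumes M: "\<And>t. M t \<in> carrier_mat m m"
    and cont: "\<And>i j. i < m \<Longrightarrow> j < m \<Longrightarrow> continuous_on {0..1} (\<lambda>t. M t $$ (i,j))"
    and Z: "\<And>t i j. t \<in> {0..1} \<Longrightarrow> i < m \<Longrightarrow> j < m \<Longrightarrow> i \<noteq> j \<Longrightarrow> M t $$ (i,j) \<le> 0"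
    and inj: "\<And>t u. t \<in> {0..1} \<Longrightarrow> u \<in> carrier_vec m \<Longrightarrow> M t *\<^sub>v u = 0\<^sub>v m \<Longrightarrow> u = 0\<^sub>v m"
    and v: "v \<in> carrier_vec m" "\<And>i. i < m \<Longrightarrow> v $ i > 0"
    and Mv: "\<And>i. i < m \<Longrightarrow> (M 0 *\<^sub>v v) $ i > 0"
  obtains y where "y \<in> carrier_vec m" "\<And>i. i < m \<Longrightarrow> y $ i > 0"
    "\<And>i. i < m \<Longrightarrow> (M 1 *\<^sub>v y) $ i > 0"
\<comment> \<open>The minimum over the entries taken below needs \<open>m > 0\<close>.\<close>
proof (cases "m = 0")
  case True
  then show ?thesis using that[of v] v by simp
next
  case False
  define b where "b = M 0 *\<^sub>v v"
  have b: "b \<in> carrier_vec m" using M[of 0] v by (simp add: b_def)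
  \<comment> \<open>Cramer's form of the solution of \<open>M t y = b\<close>; adjugate and
    determinant make its continuity visible.\<close>
  define y where "y t = (1 / det (M t)) \<cdot>\<^sub>v (adj_mat (M t) *\<^sub>v b)" for t
  have adj: "adj_mat (M t) \<in> carrier_mat m m" for t using adj_mat(1)[OF M] .
  have y: "y t \<in> carrier_vec m" for t
    using adj[of t] b by (simp add: y_def)
  have det: "det (M t) \<noteq> 0" if "t \<in> {0..1}" for t
    using det_0_iff_vec_prod_zero[OF M[of t]] inj[OF that] by blast
  have My: "M t *\<^sub>v y t = b" if "t \<in> {0..1}" for t
  proof -
    have "M t *\<^sub>v y t = (1 / det (M t)) \<cdot>\<^sub>v ((M t * adj_mat (M t)) *\<^sub>v b)"
      using M[of t] adj[of t] b by (simp add: y_def mult_mat_vec)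
    also have "\<dots> = b"
      using adj_mat(2)[OF M] det[OF that] b by (auto simp: smult_smult_assoc)
    finally show ?thesis .
  qed
  have "M 0 *\<^sub>v (y 0 - v) = 0\<^sub>v m"
    using My[of 0] M[of 0] y[of 0] v(1) b by (simp add: mult_minus_distrib_mat_vec b_def)
  then have "y 0 - v = 0\<^sub>v m" using inj[of 0] y[of 0] v by simp
  then have "y 0 $ i = v $ i" if "i < m" for i
    using that v(1) y[of 0] by (metis eq_iff_diff_eq_0 index_minus_vec(1) index_zero_vec(1) carrier_vecD)
  then have y0: "y 0 $ i > 0" if "i < m" for i using v(2) that by simp
  define f where "f t = Min ((\<lambda>i. y t $ i) ` {..<m})" for t
  have f_le: "f t \<le> y t $ i" if "i < m" for t i using that by (simp add: f_def)
  have f_attained: "\<exists>i<m. f t = y t $ i" for t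
  proof -
    have "f t \<in> (\<lambda>i. y t $ i) ` {..<m}" unfolding f_def by (rule Min_in) (use False in auto)
    then show ?thesis by auto
  qed
  have "continuous_on {0..1} (\<lambda>t. y t $ i)" if "i < m" for i
  proof -
    have "y t $ i = 1 / det (M t) * (\<Sum>j<m. adj_mat (M t) $$ (i,j) * b $ j)" for t
      using that adj[of t] by (simp add: y_def mult_mat_vec_sum[OF adj b that] del: index_mult_mat_vec)
    then show ?thesis
      using that det by (auto intro!: continuous_intros continuous_on_det[OF M cont] continuous_on_adj_mat[OF M cont])
  qed
  then have cont_f: "continuous_on {0..1} f"
    unfolding f_def using False by (intro continuous_on_Min) auto
  have "f 1 > 0"
  proof (rule ccontr)
    assume "\<not> f 1 > 0"
    moreover have "f 0 \<ge> 0" using f_attained[of 0] y0 by force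
    ultimately obtain t where t: "0 \<le> t" "t \<le> 1" "f t = 0"
      using IVT2'[of f 1 0 0] cont_f by auto
    \<comment> \<open>Any zero of \<open>f\<close> suffices: all entries of \<open>y t\<close> are
      nonnegative and entry \<open>i\<close> vanishes, so the diagonal term of row \<open>i\<close>
      drops out and the others are nonpositive.\<close>
    obtain i where i: "i < m" "y t $ i = 0" using f_attained[of t] t by auto
    have "(\<Sum>j<m. M t $$ (i,j) * y t $ j) \<le> 0"
    proof (rule sum_nonpos)
      fix j assume "j \<in> {..<m}"
      then show "M t $$ (i,j) * y t $ j \<le> 0"
        using Z[of t i j] f_le[of j t] t i by (cases "j = i") (auto intro: mult_nonpos_nonneg)
    qed
    then have "b $ i \<le> 0" using My[of t] t i by (metis M mult_mat_vec_sum y atLeastAtMost_iff)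
    then show False using Mv[OF i(1)] by (simp add: b_def)
  qed
  then have "y 1 $ i > 0" if "i < m" for i using f_le[OF that, of 1] by simp
  then show ?thesis using that[of "y 1"] y My[of 1] Mv by (simp add: b_def)
qed

subsection \<open>Stability as absence of nonzero solutions\<close>

lemma cmat_carrier [simp]: "cmat M \<in> carrier_mat k l \<longleftrightarrow> M \<in> carrier_mat k l"
  by (simp add: cmat_def)

text \<open>An inverse-free form of stability: with \<open>W = I - F \<Delta>\<close>,
  \<open>?Q\<close> is injectivity of \<open>W\<close>, and \<open>?R\<close> excludes closed-loop
  eigenvectors with \<open>Re s \<ge> 0\<close>, since the inverse of \<open>W\<close> determines
  \<open>z\<close> from \<open>x\<close>.\<close>

lemma stable_for_iff:
  assumes A: "A \<in> carrier_mat n n" and E: "E \<in> carrier_mat n q"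
    and C: "C \<in> carrier_mat q n" and F: "F \<in> carrier_mat q q" and D: "\<Delta> \<in> carrier_mat q q"
  shows "stable_for A E C F \<Delta> \<longleftrightarrow>
    (\<forall>z. z \<in> carrier_vec q \<and> z = cmat F *\<^sub>v (\<Delta> *\<^sub>v z) \<longrightarrow> z = 0\<^sub>v q) \<and>
    (\<forall>s x z. Re s \<ge> 0 \<and> x \<in> carrier_vec n \<and> z \<in> carrier_vec q \<and>
       s \<cdot>\<^sub>v x = cmat A *\<^sub>v x + cmat E *\<^sub>v (\<Delta> *\<^sub>v z) \<and>
       z = cmat C *\<^sub>v x + cmat F *\<^sub>v (\<Delta> *\<^sub>v z) \<longrightarrow> x = 0\<^sub>v n)"
    (is "_ \<longleftrightarrow> ?Q \<and> ?R")
proof -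
  define W where "W = 1\<^sub>m q - cmat F * \<Delta>"
  have car': "cmat A \<in> carrier_mat n n" "cmat E \<in> carrier_mat n q"
    "cmat C \<in> carrier_mat q n" "cmat F \<in> carrier_mat q q" using A E C F by auto
  have W: "W \<in> carrier_mat q q" unfolding W_def
    by (intro minus_carrier_mat mult_carrier_mat[OF car'(4) D])
  have Wz: "W *\<^sub>v z = z - cmat F *\<^sub>v (\<Delta> *\<^sub>v z)" if "z \<in> carrier_vec q" for z
    using that car' D by (simp add: W_def minus_mult_distrib_mat_vec[of _ q q])
  have Wz_iff: "W *\<^sub>v z = c \<longleftrightarrow> z = c + cmat F *\<^sub>v (\<Delta> *\<^sub>v z)"
    if z: "z \<in> carrier_vec q" and c: "c \<in> carrier_vec q" for z c
  proof -
    have "cmat F *\<^sub>v (\<Delta> *\<^sub>v z) \<in> carrier_vec q" using car' D z by simp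
    then show ?thesis unfolding Wz[OF z]
      using z c by (auto simp: vec_eq_iff algebra_simps)
  qed
  have stable: "stable_for A E C F \<Delta> \<longleftrightarrow> (case mat_inverse W of None \<Rightarrow> False
      | Some B \<Rightarrow> hurwitz (cmat A + cmat E * \<Delta> * B * cmat C))"
    using F by (simp add: stable_for_def W_def Let_def)
  show ?thesis
  proof (cases "mat_inverse W")
    case None
    \<comment> \<open>A singular \<open>W\<close> has a nonzero kernel vector, which violates
      \<open>?Q\<close>; both sides are false.\<close>
    have "det W = 0"
      using mat_inverse(1)[OF W None, where b="()"] det_non_zero_imp_unit[OF W, where b="()"] by blast
    then obtain z where z: "z \<in> carrier_vec q" "z \<noteq> 0\<^sub>v q" "W *\<^sub>v z = 0\<^sub>v q"
      using det_0_iff_vec_prod_zero[OF W] by blast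
    have "z = 0\<^sub>v q + cmat F *\<^sub>v (\<Delta> *\<^sub>v z)" using Wz_iff[OF z(1), of "0\<^sub>v q"] z(3) by simp
    also have "\<dots> = cmat F *\<^sub>v (\<Delta> *\<^sub>v z)" using car' D z(1) by (intro left_zero_vec) simp
    finally have "\<not> ?Q" using z by blast
    then show ?thesis by (simp add: stable None)
  next
    case (Some B)
    have B: "W * B = 1\<^sub>m q" "B * W = 1\<^sub>m q" "B \<in> carrier_mat q q"
      using mat_inverse(2)[OF W Some] by auto
    define M where "M = cmat A + cmat E * \<Delta> * B * cmat C"
    have ED: "cmat E * \<Delta> \<in> carrier_mat n q" using car'(2) D by (rule mult_carrier_mat)
    then have EDB: "cmat E * \<Delta> * B \<in> carrier_mat n q" using B(3) by (rule mult_carrier_mat)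
    then have EDBC: "cmat E * \<Delta> * B * cmat C \<in> carrier_mat n n" using car'(3) by (rule mult_carrier_mat)
    then have M: "M \<in> carrier_mat n n" unfolding M_def by simp
    have Mx: "M *\<^sub>v x = cmat A *\<^sub>v x + cmat E *\<^sub>v (\<Delta> *\<^sub>v (B *\<^sub>v (cmat C *\<^sub>v x)))"
      if x: "x \<in> carrier_vec n" for x
    proof -
      have Cx: "cmat C *\<^sub>v x \<in> carrier_vec q" using car'(3) x by (rule mult_mat_vec_carrier)
      then have BCx: "B *\<^sub>v (cmat C *\<^sub>v x) \<in> carrier_vec q" using B(3) by simp
      show ?thesis
        unfolding M_def add_mult_distrib_mat_vec[OF car'(1) EDBC x] assoc_mult_mat_vec[OF EDB car'(3) x]
          assoc_mult_mat_vec[OF ED B(3) Cx] assoc_mult_mat_vec[OF car'(2) D BCx] ..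
    qed
    have z_iff: "z = cmat C *\<^sub>v x + cmat F *\<^sub>v (\<Delta> *\<^sub>v z) \<longleftrightarrow> z = B *\<^sub>v (cmat C *\<^sub>v x)"
      if "x \<in> carrier_vec n" "z \<in> carrier_vec q" for x z
    proof -
      have c: "cmat C *\<^sub>v x \<in> carrier_vec q" using car' that by simp
      have "B *\<^sub>v (W *\<^sub>v z) = z" "W *\<^sub>v (B *\<^sub>v (cmat C *\<^sub>v x)) = cmat C *\<^sub>v x"
        using B W that c by (simp_all flip: assoc_mult_mat_vec)
      then have "W *\<^sub>v z = cmat C *\<^sub>v x \<longleftrightarrow> z = B *\<^sub>v (cmat C *\<^sub>v x)" by auto
      then show ?thesis using Wz_iff[OF that(2) c] by simp
    qed
    have Q: ?Q
    proof (intro allI impI; elim conjE)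
      fix z assume z: "z \<in> carrier_vec q" and e: "z = cmat F *\<^sub>v (\<Delta> *\<^sub>v z)"
      have "z = 0\<^sub>v q + cmat F *\<^sub>v (\<Delta> *\<^sub>v z)"
        using z by (subst e[symmetric]) simp
      then have "W *\<^sub>v z = 0\<^sub>v q" using Wz_iff[OF z, of "0\<^sub>v q"] by simp
      then have "(B * W) *\<^sub>v z = 0\<^sub>v q" using B(3) W z by (auto)
      then show "z = 0\<^sub>v q" using B(2) z by simp
    qed
    have "stable_for A E C F \<Delta> \<longleftrightarrow> hurwitz M" by (simp add: stable Some M_def)
    also have "\<dots> \<longleftrightarrow> (\<forall>s x. Re s \<ge> 0 \<and> x \<in> carrier_vec n \<and> M *\<^sub>v x = s \<cdot>\<^sub>v x \<longrightarrow> x = 0\<^sub>v n)"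
      using M unfolding hurwitz_def eigenvalue_def eigenvector_def by (auto simp: not_less[symmetric])
    also have "\<dots> \<longleftrightarrow> ?R"
    proof (intro iffI allI impI; elim conjE)
      fix s x z
      assume h: "\<forall>s x. Re s \<ge> 0 \<and> x \<in> carrier_vec n \<and> M *\<^sub>v x = s \<cdot>\<^sub>v x \<longrightarrow> x = 0\<^sub>v n"
        and s: "Re s \<ge> 0" and x: "x \<in> carrier_vec n" and z: "z \<in> carrier_vec q"
        and e1: "s \<cdot>\<^sub>v x = cmat A *\<^sub>v x + cmat E *\<^sub>v (\<Delta> *\<^sub>v z)"
        and e2: "z = cmat C *\<^sub>v x + cmat F *\<^sub>v (\<Delta> *\<^sub>v z)"
      have zB: "z = B *\<^sub>v (cmat C *\<^sub>v x)" using z_iff[OF x z] e2 by blast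
      then have "M *\<^sub>v x = s \<cdot>\<^sub>v x" using Mx[OF x] e1 by simp
      then show "x = 0\<^sub>v n" using h s x by blast
    next
      fix s x
      assume h: ?R and s: "Re s \<ge> 0" and x: "x \<in> carrier_vec n" and e: "M *\<^sub>v x = s \<cdot>\<^sub>v x"
      define z where "z = B *\<^sub>v (cmat C *\<^sub>v x)"
      have z: "z \<in> carrier_vec q" using B car' x by (simp add: z_def)
      have "s \<cdot>\<^sub>v x = cmat A *\<^sub>v x + cmat E *\<^sub>v (\<Delta> *\<^sub>v z)" using e Mx[OF x] by (simp add: z_def)
      then show "x = 0\<^sub>v n" using h s x z z_iff[OF x z] z_def by blast
    qed
    finally show ?thesis using Q by blast
  qed
qed

subsection \<open>Block-diagonal uncertainties\<close>

lemma vnorm1_pos: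
  assumes "x \<in> carrier_vec m" "x \<noteq> 0\<^sub>v m"
  shows "vnorm1 x > 0"
proof -
  obtain i where "i < m" "x $ i \<noteq> 0" using assms by (auto simp: vec_eq_iff)
  then show ?thesis unfolding vnorm1_def using assms(1) by (intro sum_pos2[of _ i]) auto
qed

text \<open>A crude constant suffices: it only serves to bound the quotients in
  \<open>mnorm1\<close>, so that the real supremum is meaningful.\<close>

lemma vnorm1_mult_bound:
  assumes M: "M \<in> carrier_mat k m" and x: "x \<in> carrier_vec m"
  shows "vnorm1 (M *\<^sub>v x) \<le> (\<Sum>i<k. \<Sum>j<m. cmod (M $$ (i,j))) * vnorm1 x"
proof -
  have "vnorm1 (M *\<^sub>v x) = (\<Sum>i<k. cmod (\<Sum>j<m. M $$ (i,j) * x $ j))"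
    using M by (simp add: vnorm1_def mult_mat_vec_sum[OF M x] del: index_mult_mat_vec)
  also have "\<dots> \<le> (\<Sum>i<k. \<Sum>j<m. cmod (M $$ (i,j)) * vnorm1 x)"
  proof (intro sum_mono order_trans[OF norm_sum])
    fix i j assume "j \<in> {..<m}"
    then have "cmod (x $ j) \<le> vnorm1 x"
      unfolding vnorm1_def using x by (intro member_le_sum) auto
    then show "cmod (M $$ (i,j) * x $ j) \<le> cmod (M $$ (i,j)) * vnorm1 x"
      by (simp add: norm_mult mult_left_mono)
  qed
  finally show ?thesis by (simp add: sum_distrib_right)
qed

text \<open>As \<open>m > 0\<close>, there are nonzero vectors, and the quotients are bounded, so
  the supremum is a genuine least upper bound. The zero vector is added back at the end.\<close>

lemma mnorm1_le_1_iff: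
  assumes M: "M \<in> carrier_mat k m" and m: "m > 0"
  shows "mnorm1 M \<le> 1 \<longleftrightarrow> (\<forall>x\<in>carrier_vec m. vnorm1 (M *\<^sub>v x) \<le> vnorm1 x)"
proof -
  define X where "X = {x :: complex vec. x \<in> carrier_vec m \<and> x \<noteq> 0\<^sub>v m}"
  have "dim_col M = m" using M by simp
  then have X: "mnorm1 M = (SUP x\<in>X. vnorm1 (M *\<^sub>v x) / vnorm1 x)"
    unfolding mnorm1_def X_def carrier_vec_def by simp
  have "unit_vec m 0 \<in> X" using m by (simp add: X_def)
  then have ne: "X \<noteq> {}" by blast
  have pos: "vnorm1 x > 0" if "x \<in> X" for x using that vnorm1_pos[of x m] by (simp add: X_def)
  have bdd: "bdd_above ((\<lambda>x. vnorm1 (M *\<^sub>v x) / vnorm1 x) ` X)"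
  proof (rule bdd_aboveI2)
    fix x assume "x \<in> X"
    then show "vnorm1 (M *\<^sub>v x) / vnorm1 x \<le> (\<Sum>i<k. \<Sum>j<m. cmod (M $$ (i,j)))"
      using vnorm1_mult_bound[OF M, of x] pos[of x] by (simp add: X_def divide_le_eq)
  qed
  have "mnorm1 M \<le> 1 \<longleftrightarrow> (\<forall>x\<in>X. vnorm1 (M *\<^sub>v x) / vnorm1 x \<le> 1)"
    unfolding X by (rule cSUP_le_iff[OF ne bdd])
  also have "\<dots> \<longleftrightarrow> (\<forall>x\<in>X. vnorm1 (M *\<^sub>v x) \<le> vnorm1 x)"
    using pos by (intro ball_cong) (auto simp: divide_le_eq)
  also have "\<dots> \<longleftrightarrow> (\<forall>x\<in>carrier_vec m. vnorm1 (M *\<^sub>v x) \<le> vnorm1 x)"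
  proof -
    have "M *\<^sub>v 0\<^sub>v m = 0\<^sub>v k" using M by auto
    then have "vnorm1 (M *\<^sub>v 0\<^sub>v m) \<le> vnorm1 (0\<^sub>v m)" by (simp add: vnorm1_def)
    then show ?thesis by (auto simp: X_def)
  qed
  finally show ?thesis .
qed

section \<open>Blocks as intervals of indices\<close>

lemma blk_off_Suc:
  "i < length qs \<Longrightarrow> blk_off qs (Suc i) = blk_off qs i + qs ! i"
  by (simp add: blk_off_def take_Suc_conv_app_nth)

lemma blk_off_mono: "i \<le> j \<Longrightarrow> blk_off qs i \<le> blk_off qs j"
proof (rule lift_Suc_mono_le[of "blk_off qs"])
  show "blk_off qs i \<le> blk_off qs (Suc i)" for i
    by (cases "i < length qs") (simp_all add: blk_off_Suc, simp add: blk_off_def)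
qed

text \<open>Offsets are monotone, so no index lies in the intervals of two different blocks; this
  settles uniqueness for the \<open>THE\<close> in \<open>blk_of\<close>.\<close>

lemma blk_of_eq:
  assumes "i < length qs" "blk_off qs i \<le> k" "k < blk_off qs (Suc i)"
  shows "blk_of qs k = i"
  unfolding blk_of_def
proof (rule the_equality)
  fix j assume j: "j < length qs \<and> blk_off qs j \<le> k \<and> k < blk_off qs (Suc j)"
  show "j = i"
  proof (rule linorder_cases[of j i])
    assume "j < i"
    then show ?thesis using blk_off_mono[of "Suc j" i qs] j assms by simp
  next
    assume "i < j"
    then show ?thesis using blk_off_mono[of "Suc i" j qs] j assms by simp
  qed
qed (use assms in simp)

lemma blk_of_bounds:
  assumes "k < sum_list qs"
  shows "blk_of qs k < length qs" "blk_off qs (blk_of qs k) \<le> k" "k < blk_off qs (Suc (blk_of qs k))"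
proof -
  have "\<exists>i<m. blk_off qs i \<le> k \<and> k < blk_off qs (Suc i)" if "k < blk_off qs m" for m
    using that
  proof (induction m)
    case 0 then show ?case by (simp add: blk_off_def)
  next
    case (Suc m)
    then show ?case by (metis less_Suc_eq not_le)
  qed
  moreover have "k < blk_off qs (length qs)" using assms by (simp add: blk_off_def)
  ultimately obtain i where "i < length qs" "blk_off qs i \<le> k" "k < blk_off qs (Suc i)" by blast
  then show "blk_of qs k < length qs" "blk_off qs (blk_of qs k) \<le> k" "k < blk_off qs (Suc (blk_of qs k))"
    using blk_of_eq by simp_all
qed

definition blk :: "nat list \<Rightarrow> nat \<Rightarrow> nat set" where
  "blk qs i = {k. k < sum_list qs \<and> blk_of qs k = i}"

lemma blk_subset: "blk qs i \<subseteq> {..<sum_list qs}"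
  by (auto simp: blk_def)

lemma finite_blk [simp]: "finite (blk qs i)"
  using blk_subset finite_subset by blast

lemma blk_eq:
  assumes "i < length qs"
  shows "blk qs i = {blk_off qs i..<blk_off qs i + qs ! i}"
proof -
  have "blk_off qs (Suc i) \<le> sum_list qs"
    using blk_off_mono[of "Suc i" "length qs" qs] assms by (simp add: blk_off_def)
  then have *: "k \<in> blk qs i \<longleftrightarrow> blk_off qs i \<le> k \<and> k < blk_off qs (Suc i)" for k
    unfolding blk_def using blk_of_eq[OF assms, of k] blk_of_bounds[of k qs] by auto
  show ?thesis by (rule Set.set_eqI) (simp only: * blk_off_Suc[OF assms] atLeastLessThan_iff)
qed

lemma sum_blk:
  assumes "i < length qs"
  shows "(\<Sum>k\<in>blk qs i. f k) = (\<Sum>a<qs ! i. f (blk_off qs i + a))"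
  unfolding blk_eq[OF assms]
  using sum.shift_bounds_nat_ivl[of f 0 "blk_off qs i" "qs ! i"]
  by (simp add: atLeast0LessThan add.commute)

lemma sum_over_blks:
  fixes f :: "nat \<Rightarrow> 'a :: comm_monoid_add"
  shows "(\<Sum>k<sum_list qs. f k) = (\<Sum>i<length qs. \<Sum>k\<in>blk qs i. f k)"
  using sum.group[of "{..<sum_list qs}" "{..<length qs}" "blk_of qs" f] blk_of_bounds(1)[of _ qs]
  by (simp add: blk_def image_subset_iff)

section \<open>Block-diagonal matrices acting block by block\<close>

definition block_diagonal :: "nat list \<Rightarrow> complex mat \<Rightarrow> bool" where
  "block_diagonal qs \<Delta> \<longleftrightarrow> (\<forall>j < sum_list qs. \<forall>k < sum_list qs.
     blk_of qs j \<noteq> blk_of qs k \<longrightarrow> \<Delta> $$ (j,k) = 0)"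

text \<open>Entries outside the diagonal blocks vanish, so restricting a vector to block
  \<open>i\<close> commutes with applying \<open>\<Delta>\<close>.\<close>

lemma block_diagonal_mult:
  assumes \<Delta>: "\<Delta> \<in> carrier_mat (sum_list qs) (sum_list qs)" "block_diagonal qs \<Delta>"
    and i: "i < length qs" and z: "z \<in> carrier_vec (sum_list qs)"
  shows "diag_block qs \<Delta> i *\<^sub>v vec (qs ! i) (\<lambda>a. z $ (blk_off qs i + a))
    = vec (qs ! i) (\<lambda>a. (\<Delta> *\<^sub>v z) $ (blk_off qs i + a))"
proof (rule eq_vecI)
  fix a assume "a < dim_vec (vec (qs ! i) (\<lambda>a. (\<Delta> *\<^sub>v z) $ (blk_off qs i + a)))"
  then have a: "a < qs ! i" by simp
  let ?k = "blk_off qs i + a"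
  have k: "?k \<in> blk qs i" using a by (simp add: blk_eq[OF i])
  have "(\<Delta> *\<^sub>v z) $ ?k = (\<Sum>l<sum_list qs. \<Delta> $$ (?k,l) * z $ l)"
    using k by (intro mult_mat_vec_sum[OF \<Delta>(1) z]) (simp add: blk_def)
  also have "\<dots> = (\<Sum>l\<in>blk qs i. \<Delta> $$ (?k,l) * z $ l)"
  proof (rule sum.mono_neutral_right)
    have "\<Delta> $$ (?k,l) = 0" if "l < sum_list qs" "l \<notin> blk qs i" for l
      using \<Delta>(2)[unfolded block_diagonal_def, rule_format, of ?k l] k that by (simp add: blk_def)
    then show "\<forall>l\<in>{..<sum_list qs} - blk qs i. \<Delta> $$ (?k,l) * z $ l = 0" by simp
  qed (simp_all add: blk_subset)
  also have "\<dots> = (diag_block qs \<Delta> i *\<^sub>v vec (qs ! i) (\<lambda>a. z $ (blk_off qs i + a))) $ a"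
    using a by (simp add: sum_blk[OF i] diag_block_def scalar_prod_def atLeast0LessThan)
  finally show "(diag_block qs \<Delta> i *\<^sub>v vec (qs ! i) (\<lambda>a. z $ (blk_off qs i + a))) $ a
    = vec (qs ! i) (\<lambda>a. (\<Delta> *\<^sub>v z) $ (blk_off qs i + a)) $ a" using a by simp
qed (simp add: diag_block_def)

text \<open>Every vector of length \<open>qs ! i\<close> is the restriction of a full vector
  (\<open>onto\<close>), so the norm bound on a block can be quantified over full vectors and
  \<open>diag_block\<close> disappears.\<close>

lemma mnorm1_diag_block_le_1_iff:
  assumes \<Delta>: "\<Delta> \<in> carrier_mat (sum_list qs) (sum_list qs)" "block_diagonal qs \<Delta>"
    and i: "i < length qs" "qs ! i > 0"
  shows "mnorm1 (diag_block qs \<Delta> i) \<le> 1 \<longleftrightarrow> (\<forall>z\<in>carrier_vec (sum_list qs).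
    (\<Sum>k\<in>blk qs i. cmod ((\<Delta> *\<^sub>v z) $ k)) \<le> (\<Sum>k\<in>blk qs i. cmod (z $ k)))"
proof -
  let ?r = "\<lambda>z. vec (qs ! i) (\<lambda>a. z $ (blk_off qs i + a)) :: complex vec"
  have carrier: "diag_block qs \<Delta> i \<in> carrier_mat (qs ! i) (qs ! i)" by (simp add: diag_block_def)
  have norm: "vnorm1 (?r z) = (\<Sum>k\<in>blk qs i. cmod (z $ k))" for z
    by (simp add: vnorm1_def sum_blk[OF i(1)])
  have onto: "x \<in> ?r ` carrier_vec (sum_list qs)" if "x \<in> carrier_vec (qs ! i)" for x
  proof
    have "blk_off qs i + a < sum_list qs" if "a < qs ! i" for a
      using that blk_subset[of qs i] blk_eq[OF i(1)] by auto
    \<comment> \<open>Only the entries on block \<open>i\<close> matter; elsewhere truncated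
      subtraction or an index beyond the length of \<open>x\<close> gives irrelevant values.\<close>
    then show "x = ?r (vec (sum_list qs) (\<lambda>k. x $ (k - blk_off qs i)))"
      using that by (intro eq_vecI) auto
  qed simp
  have "mnorm1 (diag_block qs \<Delta> i) \<le> 1 \<longleftrightarrow>
      (\<forall>x\<in>carrier_vec (qs ! i). vnorm1 (diag_block qs \<Delta> i *\<^sub>v x) \<le> vnorm1 x)"
    by (rule mnorm1_le_1_iff[OF carrier i(2)])
  also have "\<dots> \<longleftrightarrow> (\<forall>z\<in>carrier_vec (sum_list qs). vnorm1 (diag_block qs \<Delta> i *\<^sub>v ?r z) \<le> vnorm1 (?r z))"
    using onto by fastforce
  also have "\<dots> \<longleftrightarrow> (\<forall>z\<in>carrier_vec (sum_list qs).
    (\<Sum>k\<in>blk qs i. cmod ((\<Delta> *\<^sub>v z) $ k)) \<le> (\<Sum>k\<in>blk qs i. cmod (z $ k)))"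
    by (intro ball_cong) (simp_all add: block_diagonal_mult[OF \<Delta> i(1)] norm)
  finally show ?thesis .
qed

lemma Delta1_iff:
  assumes "\<forall>i < length qs. qs ! i > 0"
  shows "\<Delta> \<in> Delta1 qs \<longleftrightarrow> \<Delta> \<in> carrier_mat (sum_list qs) (sum_list qs) \<and> block_diagonal qs \<Delta> \<and>
    (\<forall>i<length qs. \<forall>z\<in>carrier_vec (sum_list qs).
      (\<Sum>k\<in>blk qs i. cmod ((\<Delta> *\<^sub>v z) $ k)) \<le> (\<Sum>k\<in>blk qs i. cmod (z $ k)))"
  using assms mnorm1_diag_block_le_1_iff[of \<Delta> qs] by (auto simp: Delta1_def block_diagonal_def)

subsection \<open>Sufficiency of the inequality\<close>

text \<open>Here \<open>\<mu>\<close> is the diagonal of \<open>D\<close>, so \<open>D\<close> times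
  the ones vector is \<open>\<mu>\<close>. The first \<open>n\<close> and the last \<open>q\<close>
  columns give the two families, and \<open>- \<mu> l\<close> comes from the identity in
  \<open>F - I\<close>.\<close>

lemma weighted_inequality_iff:
  fixes A E C F :: "real mat"
  assumes A: "A \<in> carrier_mat n n" and E: "E \<in> carrier_mat n q"
    and C: "C \<in> carrier_mat q n" and F: "F \<in> carrier_mat q q"
    and lam: "lam \<in> carrier_vec n"
  shows "(\<forall>j < n + q. (transpose_mat (four_block_mat A E C (F - 1\<^sub>m q)) *\<^sub>v
      (lam @\<^sub>v (mat q q (\<lambda>(j,k). if j = k then \<mu> j else 0) *\<^sub>v ones_vec q))) $ j < 0) \<longleftrightarrow>
    (\<forall>j<n. (\<Sum>i<n. lam $ i * A $$ (i,j)) + (\<Sum>k<q. \<mu> k * C $$ (k,j)) < 0) \<and>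
    (\<forall>l<q. (\<Sum>i<n. lam $ i * E $$ (i,l)) + (\<Sum>k<q. \<mu> k * F $$ (k,l)) - \<mu> l < 0)"
proof -
  let ?M = "four_block_mat A E C (F - 1\<^sub>m q)"
  let ?w = "mat q q (\<lambda>(j,k). if j = k then \<mu> j else 0) *\<^sub>v ones_vec q"
  have w: "?w = vec q \<mu>"
    by (intro eq_vecI)
       (auto simp: scalar_prod_def ones_vec_def if_distrib[of "\<lambda>x. x * _"] cong: if_cong)
  have split: "(\<Sum>i<n+q. g i) = (\<Sum>i<n. g i) + (\<Sum>k<q. g (n + k))" for g :: "nat \<Rightarrow> real"
    by (induction q) (simp_all add: add.assoc)
  have M: "transpose_mat ?M \<in> carrier_mat (n + q) (n + q)"
    using A F by (auto simp: minus_carrier_mat)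
  have lw: "lam @\<^sub>v vec q \<mu> \<in> carrier_vec (n + q)" using lam by simp
  have entry: "(transpose_mat ?M *\<^sub>v (lam @\<^sub>v ?w)) $ j =
      (\<Sum>i<n. lam $ i * ?M $$ (i,j)) + (\<Sum>k<q. \<mu> k * ?M $$ (n+k,j))" if "j < n + q" for j
    using that lam A F unfolding w mult_mat_vec_sum[OF M lw that] split
    by (intro arg_cong2[of _ _ _ _ "(+)"] sum.cong) auto
  have left: "(transpose_mat ?M *\<^sub>v (lam @\<^sub>v ?w)) $ j =
      (\<Sum>i<n. lam $ i * A $$ (i,j)) + (\<Sum>k<q. \<mu> k * C $$ (k,j))" if "j < n" for j
    using that A E C F by (simp add: entry del: index_mult_mat_vec)
  have right: "(transpose_mat ?M *\<^sub>v (lam @\<^sub>v ?w)) $ (n + l) =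
      (\<Sum>i<n. lam $ i * E $$ (i,l)) + (\<Sum>k<q. \<mu> k * F $$ (k,l)) - \<mu> l" if "l < q" for l
  proof -
    have "(\<Sum>k<q. \<mu> k * (F $$ (k,l) - 1\<^sub>m q $$ (k,l))) = (\<Sum>k<q. \<mu> k * F $$ (k,l)) - \<mu> l"
      using that by (simp add: right_diff_distrib sum_subtractf if_distrib[of "\<lambda>x. _ * x"] cong: if_cong)
    then show ?thesis using that A E C F by (simp add: entry del: index_mult_mat_vec index_one_mat(1))
  qed
  have "(\<forall>j<n+q. P j) \<longleftrightarrow> (\<forall>j<n. P j) \<and> (\<forall>l<q. P (n + l))" for P
    by (metis add_diff_inverse_nat nat_add_left_cancel_less trans_less_add1)
  then show ?thesis by (simp only: left right cong: imp_cong)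
qed

lemma dim_cmat [simp]: "dim_row (cmat M) = dim_row M" "dim_col (cmat M) = dim_col M"
  by (simp_all add: cmat_def)

lemma cmat_mult_vec_index:
  assumes "M \<in> carrier_mat k l" "x \<in> carrier_vec l" "i < k"
  shows "(cmat M *\<^sub>v x) $ i = (\<Sum>j<l. complex_of_real (M $$ (i,j)) * x $ j)"
  using assms by (subst mult_mat_vec_sum[of _ k l]) (auto simp: cmat_def intro!: sum.cong)

text \<open>A duality pairing: weighting \<open>in1\<close> by \<open>lam\<close> and
  \<open>in2\<close> by \<open>\<mu>\<close>, adding \<open>in3\<close> and exchanging sums yields
  \<open>sum f + sum g \<le> 0\<close>. All terms are nonnegative, hence zero, and the coefficients
  of \<open>a j\<close> and \<open>w l\<close> in them are nonzero.\<close>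

lemma weighted_sums_zero:
  fixes A E C F :: "nat \<Rightarrow> nat \<Rightarrow> real"
  assumes lam: "\<And>i. i < n \<Longrightarrow> lam i > 0" and mu: "\<And>k. k < q \<Longrightarrow> \<mu> k > 0"
    and neg1: "\<And>j. j < n \<Longrightarrow> (\<Sum>i<n. lam i * A i j) + (\<Sum>k<q. \<mu> k * C k j) < 0"
    and neg2: "\<And>l. l < q \<Longrightarrow> (\<Sum>i<n. lam i * E i l) + (\<Sum>k<q. \<mu> k * F k l) - \<mu> l < 0"
    and a: "\<And>j. j < n \<Longrightarrow> a j \<ge> 0" and w: "\<And>l. l < q \<Longrightarrow> w l \<ge> 0"
    and in1: "\<And>i. i < n \<Longrightarrow> 0 \<le> (\<Sum>j<n. A i j * a j) + (\<Sum>l<q. E i l * w l)"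
    and in2: "\<And>k. k < q \<Longrightarrow> z k \<le> (\<Sum>j<n. C k j * a j) + (\<Sum>l<q. F k l * w l)"
    and in3: "(\<Sum>k<q. \<mu> k * w k) \<le> (\<Sum>k<q. \<mu> k * z k)"
  shows "(\<forall>j<n. a j = 0) \<and> (\<forall>l<q. w l = 0)"
proof -
  define f where "f j = - ((\<Sum>i<n. lam i * A i j) + (\<Sum>k<q. \<mu> k * C k j)) * a j" for j
  define g where "g l = - ((\<Sum>i<n. lam i * E i l) + (\<Sum>k<q. \<mu> k * F k l) - \<mu> l) * w l" for l
  have f: "f j \<ge> 0" if "j < n" for j
    using neg1[OF that] a[OF that] unfolding f_def by (intro mult_nonneg_nonneg) auto
  have g: "g l \<ge> 0" if "l < q" for l
    using neg2[OF that] w[OF that] unfolding g_def by (intro mult_nonneg_nonneg) auto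
  have swap: "(\<Sum>i<m. c i * (\<Sum>j<m'. X i j * b j)) = (\<Sum>j<m'. (\<Sum>i<m. c i * X i j) * b j)"
    for m m' :: nat and c b :: "nat \<Rightarrow> real" and X
    by (simp add: sum_distrib_left sum_distrib_right mult.assoc) (rule sum.swap)
  have "0 \<le> (\<Sum>i<n. lam i * ((\<Sum>j<n. A i j * a j) + (\<Sum>l<q. E i l * w l)))"
    using lam in1 by (intro sum_nonneg) (simp add: less_imp_le)
  moreover have "(\<Sum>k<q. \<mu> k * z k) \<le> (\<Sum>k<q. \<mu> k * ((\<Sum>j<n. C k j * a j) + (\<Sum>l<q. F k l * w l)))"
    using mu in2 by (intro sum_mono mult_left_mono) (auto simp: less_imp_le)
  ultimately have "sum f {..<n} + sum g {..<q} \<le> 0"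
    using in3 by (simp add: f_def g_def distrib_left sum.distrib swap distrib_right
        left_diff_distrib sum_subtractf sum_negf)
  moreover have "sum f {..<n} \<ge> 0" "sum g {..<q} \<ge> 0" using f g by (auto intro: sum_nonneg)
  ultimately have "sum f {..<n} = 0" "sum g {..<q} = 0" by linarith+
  then have fg: "\<forall>j<n. f j = 0" "\<forall>l<q. g l = 0"
    using sum_nonneg_eq_0_iff[of "{..<n}" f] sum_nonneg_eq_0_iff[of "{..<q}" g] f g by auto
  have "a j = 0" if "j < n" for j
    using fg(1)[rule_format, OF that] neg1[OF that] unfolding f_def mult_eq_0_iff by linarith
  moreover have "w l = 0" if "l < q" for l
    using fg(2)[rule_format, OF that] neg2[OF that] unfolding g_def mult_eq_0_iff by linarith
  ultimately show ?thesis by blast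
qed

text \<open>Moving the diagonal term to the left gives \<open>(s - A i i) x i\<close>, and
  \<open>Re s \<ge> 0\<close> makes \<open>- A i i\<close> a lower bound for \<open>\<bar>s - A i i\<bar>\<close>.\<close>
lemma metzler_modulus_inequality:
  fixes A E :: "nat \<Rightarrow> nat \<Rightarrow> real" and x w :: "nat \<Rightarrow> complex"
  assumes i: "i < n" and s: "Re s \<ge> 0"
    and A: "\<And>j. j < n \<Longrightarrow> j \<noteq> i \<Longrightarrow> A i j \<ge> 0" and E: "\<And>l. l < q \<Longrightarrow> E i l \<ge> 0"
    and eq: "s * x i = (\<Sum>j<n. complex_of_real (A i j) * x j) + (\<Sum>l<q. complex_of_real (E i l) * w l)"
  shows "0 \<le> (\<Sum>j<n. A i j * cmod (x j)) + (\<Sum>l<q. E i l * cmod (w l))"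
proof -
  have split: "(\<Sum>j<n. h j) = h i + (\<Sum>j\<in>{..<n}-{i}. h j)" for h :: "nat \<Rightarrow> 'b :: comm_monoid_add"
    using i by (simp add: sum.remove)
  have "(s - complex_of_real (A i i)) * x i =
      (\<Sum>j\<in>{..<n}-{i}. complex_of_real (A i j) * x j) + (\<Sum>l<q. complex_of_real (E i l) * w l)"
    using eq split[of "\<lambda>j. complex_of_real (A i j) * x j"] by (simp add: algebra_simps)
  then have "cmod (s - complex_of_real (A i i)) * cmod (x i) =
      cmod ((\<Sum>j\<in>{..<n}-{i}. complex_of_real (A i j) * x j) + (\<Sum>l<q. complex_of_real (E i l) * w l))"
    by (metis norm_mult)
  also have "\<dots> \<le> (\<Sum>j\<in>{..<n}-{i}. cmod (complex_of_real (A i j) * x j))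
      + (\<Sum>l<q. cmod (complex_of_real (E i l) * w l))"
    by (intro order_trans[OF norm_triangle_ineq] add_mono norm_sum)
  also have "\<dots> = (\<Sum>j\<in>{..<n}-{i}. A i j * cmod (x j)) + (\<Sum>l<q. E i l * cmod (w l))"
    using A E by (intro arg_cong2[of _ _ _ _ "(+)"] sum.cong) (auto simp: norm_mult)
  finally have le: "cmod (s - complex_of_real (A i i)) * cmod (x i) \<le> \<dots>" .
  have "- A i i \<le> cmod (s - complex_of_real (A i i))"
    using complex_Re_le_cmod[of "s - complex_of_real (A i i)"] s by simp
  then have "- A i i * cmod (x i) \<le> cmod (s - complex_of_real (A i i)) * cmod (x i)"
    by (intro mult_right_mono) auto
  then show ?thesis using le split[of "\<lambda>j. A i j * cmod (x j)"] by simp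
qed

text \<open>Beyond its dimensions, \<open>\<Delta>\<close> enters only through \<open>contr\<close>,
  a contraction in the 1-norm weighted by \<open>\<mu>\<close>. Both parts of
  \<open>stable_for_iff\<close> are reduced to \<open>key\<close>.\<close>

lemma weighted_inequality_imp_stable:
  fixes A E C F :: "real mat"
  assumes A: "A \<in> carrier_mat n n" and E: "E \<in> carrier_mat n q"
    and C: "C \<in> carrier_mat q n" and F: "F \<in> carrier_mat q q" and \<Delta>: "\<Delta> \<in> carrier_mat q q"
    and pos: "metzler A" "nonneg_mat E" "nonneg_mat C" "nonneg_mat F"
    and lam: "\<And>i. i < n \<Longrightarrow> lam i > 0" and mu: "\<And>k. k < q \<Longrightarrow> \<mu> k > 0"
    and neg1: "\<And>j. j < n \<Longrightarrow> (\<Sum>i<n. lam i * A $$ (i,j)) + (\<Sum>k<q. \<mu> k * C $$ (k,j)) < 0"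
    and neg2: "\<And>l. l < q \<Longrightarrow> (\<Sum>i<n. lam i * E $$ (i,l)) + (\<Sum>k<q. \<mu> k * F $$ (k,l)) - \<mu> l < 0"
    and contr: "\<And>z. z \<in> carrier_vec q \<Longrightarrow>
      (\<Sum>k<q. \<mu> k * cmod ((\<Delta> *\<^sub>v z) $ k)) \<le> (\<Sum>k<q. \<mu> k * cmod (z $ k))"
  shows "stable_for A E C F \<Delta>"
proof -
  have sgn: "A $$ (i,j) \<ge> 0" if "i < n" "j < n" "j \<noteq> i" for i j
    using that pos A by (auto simp: metzler_def)
  have sgn': "E $$ (i,l) \<ge> 0" "C $$ (l,i) \<ge> 0" if "i < n" "l < q" for i l
    using that pos E C by (auto simp: nonneg_mat_def)
  have sgn'': "F $$ (k,l) \<ge> 0" if "k < q" "l < q" for k l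
    using that pos F by (auto simp: nonneg_mat_def)
  have key: "x = 0\<^sub>v n \<and> \<Delta> *\<^sub>v z = 0\<^sub>v q"
    if x: "x \<in> carrier_vec n" and z: "z \<in> carrier_vec q"
      and e: "z = cmat C *\<^sub>v x + cmat F *\<^sub>v (\<Delta> *\<^sub>v z)"
      and in1: "\<And>i. i < n \<Longrightarrow> 0 \<le> (\<Sum>j<n. A $$ (i,j) * cmod (x $ j)) +
          (\<Sum>l<q. E $$ (i,l) * cmod ((\<Delta> *\<^sub>v z) $ l))" for x z
  proof -
    define w where "w = \<Delta> *\<^sub>v z"
    have w: "w \<in> carrier_vec q" using \<Delta> z by (simp add: w_def)
    have in2: "cmod (z $ k) \<le> (\<Sum>j<n. C $$ (k,j) * cmod (x $ j)) + (\<Sum>l<q. F $$ (k,l) * cmod (w $ l))"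
      if k: "k < q" for k
    proof -
      have "z $ k = (cmat C *\<^sub>v x + cmat F *\<^sub>v w) $ k" using e by (simp add: w_def)
      also have "\<dots> = (\<Sum>j<n. complex_of_real (C $$ (k,j)) * x $ j) + (\<Sum>l<q. complex_of_real (F $$ (k,l)) * w $ l)"
        using k F by (subst index_add_vec)
          (simp_all add: cmat_mult_vec_index[OF C x] cmat_mult_vec_index[OF F w] del: index_mult_mat_vec)
      finally have "cmod (z $ k) \<le> (\<Sum>j<n. cmod (complex_of_real (C $$ (k,j)) * x $ j))
          + (\<Sum>l<q. cmod (complex_of_real (F $$ (k,l)) * w $ l))"
        by (simp only:) (intro order_trans[OF norm_triangle_ineq] add_mono norm_sum)
      also have "\<dots> = (\<Sum>j<n. C $$ (k,j) * cmod (x $ j)) + (\<Sum>l<q. F $$ (k,l) * cmod (w $ l))"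
        using k sgn' sgn'' by (intro arg_cong2[of _ _ _ _ "(+)"] sum.cong) (auto simp: norm_mult)
      finally show ?thesis .
    qed
    have "(\<forall>j<n. cmod (x $ j) = 0) \<and> (\<forall>l<q. cmod (w $ l) = 0)"
    proof (rule weighted_sums_zero[of n lam q \<mu> "\<lambda>i j. A $$ (i,j)" "\<lambda>k j. C $$ (k,j)"
          "\<lambda>i l. E $$ (i,l)" "\<lambda>k l. F $$ (k,l)" _ _ "\<lambda>k. cmod (z $ k)"])
      show "(\<Sum>k<q. \<mu> k * cmod (w $ k)) \<le> (\<Sum>k<q. \<mu> k * cmod (z $ k))"
        using contr[OF z] by (simp add: w_def)
    qed (use lam mu neg1 neg2 in1 in2 in \<open>auto simp: w_def\<close>)
    then show ?thesis using x w unfolding w_def[symmetric] by (auto simp: vec_eq_iff)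
  qed
  show ?thesis
    unfolding stable_for_iff[OF A E C F \<Delta>]
  proof (intro conjI allI impI; elim conjE)
    fix z assume z: "z \<in> carrier_vec q" and e: "z = cmat F *\<^sub>v (\<Delta> *\<^sub>v z)"
    have Fw: "cmat F *\<^sub>v (\<Delta> *\<^sub>v z) \<in> carrier_vec q" using e z by simp
    \<comment> \<open>Well-posedness is the case \<open>x = 0\<close>: \<open>key\<close> gives
      \<open>\<Delta> z = 0\<close>, and then \<open>z = F (\<Delta> z) = 0\<close>.\<close>
    have "cmat C *\<^sub>v 0\<^sub>v n = 0\<^sub>v q" using C by (auto simp: cmat_def)
    then have "z = cmat C *\<^sub>v 0\<^sub>v n + cmat F *\<^sub>v (\<Delta> *\<^sub>v z)" using e Fw by simp
    moreover have "0 \<le> (\<Sum>j<n. A $$ (i,j) * cmod (0\<^sub>v n $ j)) + (\<Sum>l<q. E $$ (i,l) * cmod ((\<Delta> *\<^sub>v z) $ l))"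
      if "i < n" for i
      using that sgn' by (auto intro!: sum_nonneg add_nonneg_nonneg)
    ultimately have "\<Delta> *\<^sub>v z = 0\<^sub>v q" using key[of "0\<^sub>v n" z] z by simp
    then have "z = cmat F *\<^sub>v 0\<^sub>v q" using e by simp
    then show "z = 0\<^sub>v q" using F by (auto simp: cmat_def)
  next
    fix s x z
    assume s: "Re s \<ge> 0" and x: "x \<in> carrier_vec n" and z: "z \<in> carrier_vec q"
      and e1: "s \<cdot>\<^sub>v x = cmat A *\<^sub>v x + cmat E *\<^sub>v (\<Delta> *\<^sub>v z)"
      and e2: "z = cmat C *\<^sub>v x + cmat F *\<^sub>v (\<Delta> *\<^sub>v z)"
    have w: "\<Delta> *\<^sub>v z \<in> carrier_vec q" using \<Delta> z by simp
    have "0 \<le> (\<Sum>j<n. A $$ (i,j) * cmod (x $ j)) + (\<Sum>l<q. E $$ (i,l) * cmod ((\<Delta> *\<^sub>v z) $ l))"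
      if i: "i < n" for i
    proof (rule metzler_modulus_inequality[OF i s, where A = "\<lambda>i j. A $$ (i,j)" and E = "\<lambda>i l. E $$ (i,l)"])
      have "s * x $ i = (s \<cdot>\<^sub>v x) $ i" using i x by simp
      also have "\<dots> = (cmat A *\<^sub>v x) $ i + (cmat E *\<^sub>v (\<Delta> *\<^sub>v z)) $ i"
        using i E by (simp add: e1 del: index_mult_mat_vec)
      finally show "s * x $ i = (\<Sum>j<n. complex_of_real (A $$ (i,j)) * x $ j)
          + (\<Sum>l<q. complex_of_real (E $$ (i,l)) * (\<Delta> *\<^sub>v z) $ l)"
        using i by (simp only: cmat_mult_vec_index[OF A x] cmat_mult_vec_index[OF E w])
    qed (use i sgn sgn' in auto)
    then show "x = 0\<^sub>v n" using key[OF x z e2] by blast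
  qed
qed

subsection \<open>Necessity of the inequality\<close>

text \<open>The multipliers of the first \<open>n\<close> inequalities form \<open>x\<close>, those
  of the last \<open>q\<close> form \<open>w\<close>. The certificate at the unknown
  \<open>lam i\<close> is the inequality in \<open>A\<close> and \<open>E\<close>; at
  \<open>d b\<close>, shared by a whole block, it is the inequality of block sums.\<close>

lemma weighted_inequality_alternative:
  fixes A E C F :: "nat \<Rightarrow> nat \<Rightarrow> real" and qs :: "nat list"
  defines "q \<equiv> sum_list qs"
  assumes no: "\<nexists>lam d. (\<forall>i<n. lam i > 0) \<and> (\<forall>b<length qs. d b > 0) \<and>
      (\<forall>j<n. (\<Sum>i<n. lam i * A i j) + (\<Sum>k<q. d (blk_of qs k) * C k j) < 0) \<and>
      (\<forall>l<q. (\<Sum>i<n. lam i * E i l) + (\<Sum>k<q. d (blk_of qs k) * F k l) - d (blk_of qs l) < 0)"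
  obtains x w where "\<And>i. i < n \<Longrightarrow> x i \<ge> 0" "\<And>k. k < q \<Longrightarrow> w k \<ge> 0"
    "(\<exists>i<n. x i > 0) \<or> (\<exists>k<q. w k > 0)"
    "\<And>i. i < n \<Longrightarrow> 0 \<le> (\<Sum>j<n. A i j * x j) + (\<Sum>l<q. E i l * w l)"
    "\<And>b. b < length qs \<Longrightarrow> (\<Sum>k\<in>blk qs b. w k) \<le>
       (\<Sum>k\<in>blk qs b. (\<Sum>j<n. C k j * x j) + (\<Sum>l<q. F k l * w l))"
proof -
  define I where "I = {..<n} <+> {..<q}"
  define J where "J = {..<n} <+> {..<length qs}"
  \<comment> \<open>\<open>r\<close> picks one of the \<open>n + q\<close> strict inequalities,
    \<open>v\<close> one of the unknowns \<open>lam i\<close> or \<open>d b\<close>. As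
    \<open>d b\<close> multiplies all rows of block \<open>b\<close>, its coefficient is a column
    sum over that block.\<close>
  define g where "g r v = (case r of
      Inl j \<Rightarrow> (case v of Inl i \<Rightarrow> A i j | Inr b \<Rightarrow> (\<Sum>k\<in>blk qs b. C k j))
    | Inr l \<Rightarrow> (case v of Inl i \<Rightarrow> E i l | Inr b \<Rightarrow> (\<Sum>k\<in>blk qs b. F k l - (if k = l then 1 else 0))))"
    for r v :: "nat + nat"
  have fin: "finite I" "finite J" by (simp_all add: I_def J_def)
  have weight: "(\<Sum>b<length qs. (\<Sum>k\<in>blk qs b. h k) * d b) = (\<Sum>k<q. d (blk_of qs k) * h k)"
    for h d :: "nat \<Rightarrow> real"
    unfolding q_def sum_over_blks
    unfolding sum_distrib_right by (intro sum.cong refl) (simp add: blk_def)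
  have none: "\<nexists>y. (\<forall>v\<in>J. y v > 0) \<and> (\<forall>r\<in>I. (\<Sum>v\<in>J. g r v * y v) < 0)"
  proof
    assume "\<exists>y. (\<forall>v\<in>J. y v > 0) \<and> (\<forall>r\<in>I. (\<Sum>v\<in>J. g r v * y v) < 0)"
    then obtain y where y: "\<forall>v\<in>J. y v > 0" and neg: "\<forall>r\<in>I. (\<Sum>v\<in>J. g r v * y v) < 0" by blast
    define lam where "lam i = y (Inl i)" for i
    define d where "d b = y (Inr b)" for b
    have sum_J: "(\<Sum>v\<in>J. g r v * y v) = (\<Sum>i<n. g r (Inl i) * lam i) + (\<Sum>b<length qs. g r (Inr b) * d b)" for r
      by (simp add: J_def sum.Plus lam_def d_def)
    have 1: "(\<Sum>i<n. lam i * A i j) + (\<Sum>k<q. d (blk_of qs k) * C k j) < 0" if "j < n" for j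
    proof -
      have "(\<Sum>i<n. A i j * lam i) + (\<Sum>k<q. d (blk_of qs k) * C k j) < 0"
        using neg[rule_format, of "Inl j"] that unfolding sum_J by (simp add: I_def g_def weight InlI InrI)
      then show ?thesis by (simp add: mult.commute)
    qed
    have 2: "(\<Sum>i<n. lam i * E i l) + (\<Sum>k<q. d (blk_of qs k) * F k l) - d (blk_of qs l) < 0" if "l < q" for l
    proof -
      have "(\<Sum>i<n. E i l * lam i) + (\<Sum>k<q. d (blk_of qs k) * (F k l - (if k = l then 1 else 0))) < 0"
        using neg[rule_format, of "Inr l"] that unfolding sum_J by (simp add: I_def g_def weight InlI InrI)
      then show ?thesis
        using that by (simp add: right_diff_distrib sum_subtractf mult.commute
            if_distrib[of "\<lambda>x. _ * x"] cong: if_cong)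
    qed
    have "\<forall>i<n. lam i > 0" "\<forall>b<length qs. d b > 0" using y by (auto simp: J_def lam_def d_def)
    with 1 2 no show False by blast
  qed
  obtain p where p: "\<And>r. r \<in> I \<Longrightarrow> p r \<ge> 0" "\<exists>r\<in>I. p r > 0"
    "\<And>v. v \<in> J \<Longrightarrow> (\<Sum>r\<in>I. p r * g r v) \<ge> 0"
    by (rule positive_alternative[OF fin none]) blast
  define x where "x i = p (Inl i)" for i
  define w where "w k = p (Inr k)" for k
  have sum_I: "(\<Sum>r\<in>I. p r * g r v) = (\<Sum>j<n. x j * g (Inl j) v) + (\<Sum>l<q. w l * g (Inr l) v)" for v
    by (simp add: I_def sum.Plus x_def w_def)
  show thesis
  proof (rule that[of x w])
    show "x i \<ge> 0" if "i < n" for i using p(1) that by (simp add: x_def I_def InlI)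
    show "w k \<ge> 0" if "k < q" for k using p(1) that by (simp add: w_def I_def InrI)
    show "(\<exists>i<n. x i > 0) \<or> (\<exists>k<q. w k > 0)" using p(2) by (auto simp: x_def w_def I_def)
    show "0 \<le> (\<Sum>j<n. A i j * x j) + (\<Sum>l<q. E i l * w l)" if "i < n" for i
      using p(3)[of "Inl i"] that unfolding sum_I by (simp add: J_def g_def InlI mult.commute)
    show "(\<Sum>k\<in>blk qs b. w k) \<le> (\<Sum>k\<in>blk qs b. (\<Sum>j<n. C k j * x j) + (\<Sum>l<q. F k l * w l))"
      if "b < length qs" for b
    proof -
      have "(\<Sum>l<q. w l * (\<Sum>k\<in>blk qs b. F k l - (if k = l then 1 else 0)))
          = (\<Sum>k\<in>blk qs b. \<Sum>l<q. w l * (F k l - (if k = l then 1 else 0)))"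
        unfolding sum_distrib_left by (rule sum.swap)
      also have "\<dots> = (\<Sum>k\<in>blk qs b. (\<Sum>l<q. F k l * w l) - w k)"
      proof (rule sum.cong[OF refl])
        fix k assume "k \<in> blk qs b"
        then have "k < q" by (simp add: blk_def q_def)
        then show "(\<Sum>l<q. w l * (F k l - (if k = l then 1 else 0))) = (\<Sum>l<q. F k l * w l) - w k"
          by (simp add: right_diff_distrib sum_subtractf mult.commute if_distrib[of "\<lambda>x. _ * x"] cong: if_cong)
      qed
      finally have F: "(\<Sum>l<q. w l * (\<Sum>k\<in>blk qs b. F k l - (if k = l then 1 else 0)))
        = (\<Sum>k\<in>blk qs b. (\<Sum>l<q. F k l * w l)) - (\<Sum>k\<in>blk qs b. w k)" by (simp add: sum_subtractf)
      have C: "(\<Sum>j<n. x j * (\<Sum>k\<in>blk qs b. C k j)) = (\<Sum>k\<in>blk qs b. \<Sum>j<n. C k j * x j)"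
        unfolding sum_distrib_left by (subst sum.swap) (simp add: mult.commute)
      have "0 \<le> (\<Sum>j<n. x j * (\<Sum>k\<in>blk qs b. C k j)) +
          (\<Sum>l<q. w l * (\<Sum>k\<in>blk qs b. F k l - (if k = l then 1 else 0)))"
        using p(3)[of "Inr b"] that unfolding sum_I by (simp add: J_def g_def InrI)
      then show ?thesis unfolding F C by (simp add: sum.distrib)
    qed
  qed
qed

text \<open>The matrix \<open>w (1, \<dots>, 1) / \<zeta> i\<close> on block \<open>i\<close>; where \<open>\<zeta> i = 0\<close>, division by zero makes
  the block vanish.\<close>
definition block_rank_one :: "nat list \<Rightarrow> (nat \<Rightarrow> real) \<Rightarrow> (nat \<Rightarrow> real) \<Rightarrow> real mat" where
  "block_rank_one qs w \<zeta> = mat (sum_list qs) (sum_list qs)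
     (\<lambda>(k,l). if blk_of qs k = blk_of qs l then w k / \<zeta> (blk_of qs k) else 0)"

lemma block_rank_one_carrier [simp]:
  "block_rank_one qs w \<zeta> \<in> carrier_mat (sum_list qs) (sum_list qs)"
  by (simp add: block_rank_one_def)

text \<open>The field is left general because the identity serves complex vectors in the norm bound
  and a real one in \<open>R z = w\<close>.\<close>

lemma block_rank_one_mult:
  fixes z :: "nat \<Rightarrow> 'a :: real_normed_field"
  assumes "k < sum_list qs"
  shows "(\<Sum>l<sum_list qs. of_real (block_rank_one qs w \<zeta> $$ (k,l)) * z l) =
    of_real (w k / \<zeta> (blk_of qs k)) * (\<Sum>l\<in>blk qs (blk_of qs k). z l)"
proof -
  have "(\<Sum>l<sum_list qs. of_real (block_rank_one qs w \<zeta> $$ (k,l)) * z l) =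
    (\<Sum>l\<in>blk qs (blk_of qs k). of_real (block_rank_one qs w \<zeta> $$ (k,l)) * z l)"
    using assms by (intro sum.mono_neutral_right) (auto simp: blk_def block_rank_one_def)
  also have "\<dots> = (\<Sum>l\<in>blk qs (blk_of qs k). of_real (w k / \<zeta> (blk_of qs k)) * z l)"
    using assms by (intro sum.cong refl) (auto simp: blk_def block_rank_one_def)
  finally show ?thesis by (simp add: sum_distrib_left)
qed

text \<open>Each column of block \<open>i\<close> sums to \<open>t\<close> times the sum of
  \<open>w\<close> over the block divided by \<open>\<zeta> i\<close>, which is at most 1 by
  \<open>le\<close> (and 0 if \<open>\<zeta> i = 0\<close>). A nonnegative matrix with such column
  sums does not increase the 1-norm.\<close>

lemma block_rank_one_in_Delta1:
  assumes qs: "\<forall>i < length qs. qs ! i > 0"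
    and w: "\<And>k. k < sum_list qs \<Longrightarrow> w k \<ge> 0"
    and le: "\<And>i. i < length qs \<Longrightarrow> (\<Sum>k\<in>blk qs i. w k) \<le> \<zeta> i"
    and t: "0 \<le> t" "t \<le> 1"
  shows "cmat (t \<cdot>\<^sub>m block_rank_one qs w \<zeta>) \<in> Delta1 qs"
proof -
  define q where "q = sum_list qs"
  let ?R = "block_rank_one qs w \<zeta>"
  have R: "?R \<in> carrier_mat q q" "t \<cdot>\<^sub>m ?R \<in> carrier_mat q q" by (simp_all add: q_def)
  have "block_diagonal qs (cmat (t \<cdot>\<^sub>m ?R))"
    by (simp add: block_diagonal_def cmat_def block_rank_one_def)
  moreover have "(\<Sum>k\<in>blk qs i. cmod ((cmat (t \<cdot>\<^sub>m ?R) *\<^sub>v z) $ k)) \<le> (\<Sum>k\<in>blk qs i. cmod (z $ k))"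
    if i: "i < length qs" and z: "z \<in> carrier_vec q" for i z
  proof -
    define S where "S = (\<Sum>k\<in>blk qs i. cmod (z $ k))"
    have S: "S \<ge> 0" by (simp add: S_def sum_nonneg)
    have w_blk: "w k \<ge> 0" if "k \<in> blk qs i" for k using w that by (simp add: blk_def)
    then have sum_w: "(\<Sum>k\<in>blk qs i. w k) \<ge> 0" by (intro sum_nonneg)
    then have \<zeta>: "\<zeta> i \<ge> 0" using le[OF i] by simp
    have "cmod ((cmat (t \<cdot>\<^sub>m ?R) *\<^sub>v z) $ k) \<le> w k / \<zeta> i * S" if k: "k \<in> blk qs i" for k
    proof -
      have kq: "k < q" and ki: "blk_of qs k = i" using k by (auto simp: blk_def q_def)
      have "(cmat (t \<cdot>\<^sub>m ?R) *\<^sub>v z) $ k = of_real t * (\<Sum>l<q. of_real (?R $$ (k,l)) * z $ l)"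
        using R(1) kq by (simp add: cmat_mult_vec_index[OF R(2) z kq] sum_distrib_left mult.assoc del: index_mult_mat_vec)
      also have "\<dots> = of_real (t * (w k / \<zeta> i)) * (\<Sum>l\<in>blk qs i. z $ l)"
        using block_rank_one_mult[of k qs w \<zeta> "\<lambda>l. z $ l"] kq ki by (simp add: q_def)
      finally have "cmod ((cmat (t \<cdot>\<^sub>m ?R) *\<^sub>v z) $ k) = \<bar>t * (w k / \<zeta> i)\<bar> * cmod (\<Sum>l\<in>blk qs i. z $ l)"
        by (simp only: norm_mult norm_of_real)
      also have "\<dots> \<le> w k / \<zeta> i * S"
      proof (intro mult_mono)
        have "w k / \<zeta> i \<ge> 0" using w_blk[OF k] \<zeta> by simp
        then show "\<bar>t * (w k / \<zeta> i)\<bar> \<le> w k / \<zeta> i"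
          using t by (simp only: abs_mult abs_of_nonneg mult_left_le_one_le)
      qed (use w_blk[OF k] \<zeta> in \<open>auto simp: S_def intro: norm_sum\<close>)
      finally show ?thesis .
    qed
    then have "(\<Sum>k\<in>blk qs i. cmod ((cmat (t \<cdot>\<^sub>m ?R) *\<^sub>v z) $ k)) \<le> (\<Sum>k\<in>blk qs i. w k / \<zeta> i * S)"
      by (intro sum_mono)
    also have "\<dots> = (\<Sum>k\<in>blk qs i. w k) / \<zeta> i * S"
      by (simp add: sum_distrib_right sum_divide_distrib)
    also have "\<dots> \<le> 1 * S"
      using le[OF i] sum_w \<zeta> S by (intro mult_right_mono) (auto simp: divide_le_eq)
    finally show ?thesis by (simp add: S_def)
  qed
  ultimately show ?thesis using R(2) unfolding Delta1_iff[OF qs] q_def by simp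
qed

section \<open>The closed-loop equations as one real matrix\<close>

lemma smult_mat_mult_vec:
  fixes M :: "'a :: comm_semiring_0 mat"
  assumes "M \<in> carrier_mat k l" "z \<in> carrier_vec l"
  shows "(t \<cdot>\<^sub>m M) *\<^sub>v z = t \<cdot>\<^sub>v (M *\<^sub>v z)"
  using assms by (intro eq_vecI) (auto simp: scalar_prod_def sum_distrib_left mult.assoc)

text \<open>The matrix of the equations \<open>s x = A x + t E R z\<close>, \<open>z = C x + t F R z\<close>.\<close>
definition interconnection :: "real mat \<Rightarrow> real mat \<Rightarrow> real mat \<Rightarrow> real mat \<Rightarrow> real mat \<Rightarrow> real \<Rightarrow> real \<Rightarrow> real mat" where
  "interconnection A E C F R s t = four_block_mat
     (s \<cdot>\<^sub>m 1\<^sub>m (dim_row A) - A) (- (t \<cdot>\<^sub>m (E * R))) (- C) (1\<^sub>m (dim_row F) - t \<cdot>\<^sub>m (F * R))"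

lemma interconnection_carrier:
  assumes "A \<in> carrier_mat n n" "E \<in> carrier_mat n q"
    "C \<in> carrier_mat q n" "F \<in> carrier_mat q q" "R \<in> carrier_mat q q"
  shows "interconnection A E C F R s t \<in> carrier_mat (n + q) (n + q)"
  using assms unfolding interconnection_def by (intro four_block_carrier_mat) (auto intro!: minus_carrier_mat)

lemma interconnection_mult:
  assumes A: "A \<in> carrier_mat n n" and E: "E \<in> carrier_mat n q"
    and C: "C \<in> carrier_mat q n" and F: "F \<in> carrier_mat q q" and R: "R \<in> carrier_mat q q"
    and x: "x \<in> carrier_vec n" and z: "z \<in> carrier_vec q"
  shows "interconnection A E C F R s t *\<^sub>v (x @\<^sub>v z) =
    (s \<cdot>\<^sub>v x - A *\<^sub>v x - t \<cdot>\<^sub>v (E *\<^sub>v (R *\<^sub>v z))) @\<^sub>v (z - C *\<^sub>v x - t \<cdot>\<^sub>v (F *\<^sub>v (R *\<^sub>v z)))"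
proof -
  have ER: "E * R \<in> carrier_mat n q" and FR: "F * R \<in> carrier_mat q q" using E F R by auto
  have Rz: "R *\<^sub>v z \<in> carrier_vec q" using R z by simp
  have cs: "s \<cdot>\<^sub>m 1\<^sub>m n - A \<in> carrier_mat n n" "- (t \<cdot>\<^sub>m (E * R)) \<in> carrier_mat n q"
    "- C \<in> carrier_mat q n" "1\<^sub>m q - t \<cdot>\<^sub>m (F * R) \<in> carrier_mat q q"
    using A ER C FR by (auto intro!: minus_carrier_mat)
  have Ax: "A *\<^sub>v x \<in> carrier_vec n" and Cx: "C *\<^sub>v x \<in> carrier_vec q"
    and ERz: "E *\<^sub>v (R *\<^sub>v z) \<in> carrier_vec n" and FRz: "F *\<^sub>v (R *\<^sub>v z) \<in> carrier_vec q"
    using A C E F x Rz by auto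
  have 1: "(s \<cdot>\<^sub>m 1\<^sub>m n - A) *\<^sub>v x = s \<cdot>\<^sub>v x - A *\<^sub>v x"
    using A x by (subst minus_mult_distrib_mat_vec[of _ n n]) (auto simp: smult_mat_mult_vec[of _ n n])
  have 2: "(- (t \<cdot>\<^sub>m (E * R))) *\<^sub>v z = - (t \<cdot>\<^sub>v (E *\<^sub>v (R *\<^sub>v z)))"
    using ER R z by (simp add: smult_mat_mult_vec[OF ER z] assoc_mult_mat_vec[OF E R z])
  have 3: "(- C) *\<^sub>v x = - (C *\<^sub>v x)" using C x by simp
  have 4: "(1\<^sub>m q - t \<cdot>\<^sub>m (F * R)) *\<^sub>v z = z - t \<cdot>\<^sub>v (F *\<^sub>v (R *\<^sub>v z))"
    using FR z by (subst minus_mult_distrib_mat_vec[of _ q q])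
      (auto simp: smult_mat_mult_vec[OF FR z] assoc_mult_mat_vec[OF F R z])
  have "interconnection A E C F R s t *\<^sub>v (x @\<^sub>v z) =
    ((s \<cdot>\<^sub>m 1\<^sub>m n - A) *\<^sub>v x + (- (t \<cdot>\<^sub>m (E * R))) *\<^sub>v z) @\<^sub>v ((- C) *\<^sub>v x + (1\<^sub>m q - t \<cdot>\<^sub>m (F * R)) *\<^sub>v z)"
    using A F four_block_mat_mult_vec[OF cs x z] by (simp add: interconnection_def)
  also have "\<dots> = (s \<cdot>\<^sub>v x - A *\<^sub>v x - t \<cdot>\<^sub>v (E *\<^sub>v (R *\<^sub>v z))) @\<^sub>v (z - C *\<^sub>v x - t \<cdot>\<^sub>v (F *\<^sub>v (R *\<^sub>v z)))"
  proof -
    have "a + - b = a - b" if "a \<in> carrier_vec k" "b \<in> carrier_vec k" for a b :: "real vec" and k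
      using that by auto
    moreover have "- a + (b - c) = b - a - c"
      if "a \<in> carrier_vec k" "b \<in> carrier_vec k" "c \<in> carrier_vec k" for a b c :: "real vec" and k
      using that by (intro eq_vecI) auto
    ultimately show ?thesis
      unfolding 1 2 3 4 using x z Ax Cx ERz FRz by (metis minus_carrier_vec smult_carrier_vec)
  qed
  finally show ?thesis .
qed

lemma zero_append_vec: "0\<^sub>v n @\<^sub>v 0\<^sub>v q = 0\<^sub>v (n + q)"
  by (rule eq_vecI) auto

text \<open>A kernel vector splits into real \<open>x\<close>, \<open>z\<close> solving the
  equations for \<open>\<Delta> = t R\<close>. Over the complex numbers, stability first forces
  \<open>x = 0\<close>; what remains is the equation of well-posedness, which forces
  \<open>z = 0\<close>.\<close>

lemma interconnection_nonsingular:
  assumes A: "A \<in> carrier_mat n n" and E: "E \<in> carrier_mat n q"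
    and C: "C \<in> carrier_mat q n" and F: "F \<in> carrier_mat q q" and R: "R \<in> carrier_mat q q"
    and stable: "stable_for A E C F (cmat (t \<cdot>\<^sub>m R))" and s: "s \<ge> 0"
    and u: "u \<in> carrier_vec (n + q)" and Mu: "interconnection A E C F R s t *\<^sub>v u = 0\<^sub>v (n + q)"
  shows "u = 0\<^sub>v (n + q)"
proof -
  define x where "x = vec_first u n"
  define z where "z = vec_last u q"
  have x: "x \<in> carrier_vec n" and z: "z \<in> carrier_vec q" by (simp_all add: x_def z_def)
  have uxz: "u = x @\<^sub>v z" using vec_first_last_append[OF u] by (simp add: x_def z_def)
  define w where "w = t \<cdot>\<^sub>v (R *\<^sub>v z)"
  have w: "w \<in> carrier_vec q" using R z by (simp add: w_def)
  have Ew: "E *\<^sub>v w = t \<cdot>\<^sub>v (E *\<^sub>v (R *\<^sub>v z))" and Fw: "F *\<^sub>v w = t \<cdot>\<^sub>v (F *\<^sub>v (R *\<^sub>v z))"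
    using E F R z by (auto simp: w_def mult_mat_vec)
  have split: "(s \<cdot>\<^sub>v x - A *\<^sub>v x - E *\<^sub>v w) @\<^sub>v (z - C *\<^sub>v x - F *\<^sub>v w) = 0\<^sub>v n @\<^sub>v 0\<^sub>v q"
    using Mu unfolding uxz interconnection_mult[OF A E C F R x z] Ew Fw zero_append_vec .
  have cs: "A *\<^sub>v x \<in> carrier_vec n" "E *\<^sub>v w \<in> carrier_vec n" "C *\<^sub>v x \<in> carrier_vec q" "F *\<^sub>v w \<in> carrier_vec q"
    using A E C F x w by auto
  have zero: "s \<cdot>\<^sub>v x - A *\<^sub>v x - E *\<^sub>v w = 0\<^sub>v n" "z - C *\<^sub>v x - F *\<^sub>v w = 0\<^sub>v q"
    using split cs x z by (subst (asm) append_vec_eq[of _ n]; simp)+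
  have move: "a = b + c" if "a - b - c = 0\<^sub>v k" "a \<in> carrier_vec k" "b \<in> carrier_vec k" "c \<in> carrier_vec k"
    for a b c :: "real vec" and k
  proof (rule eq_vecI)
    fix i assume "i < dim_vec (b + c)"
    then have i: "i < k" using that by simp
    then have "(a - b - c) $ i = 0" using that(1) by simp
    then show "a $ i = (b + c) $ i" using i that(2-4) by simp
  qed (use that in simp)
  have e1: "s \<cdot>\<^sub>v x = A *\<^sub>v x + E *\<^sub>v w" and e2: "z = C *\<^sub>v x + F *\<^sub>v w"
    using move[OF zero(1)] move[OF zero(2)] x z cs by auto
  let ?h = "map_vec complex_of_real"
  have hom: "cmat M *\<^sub>v ?h v = ?h (M *\<^sub>v v)" if "M \<in> carrier_mat k l" "v \<in> carrier_vec l" for M v k l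
    using that by (intro eq_vecI) (auto simp: cmat_def scalar_prod_def)
  have hw: "cmat (t \<cdot>\<^sub>m R) *\<^sub>v ?h z = ?h w"
    using hom[of "t \<cdot>\<^sub>m R" q q z] R z by (simp add: w_def smult_mat_mult_vec[OF R z])
  have hadd: "?h (a + b) = ?h a + ?h b" if "a \<in> carrier_vec k" "b \<in> carrier_vec k" for a b k
    using that by auto
  have "complex_of_real s \<cdot>\<^sub>v ?h x = ?h (s \<cdot>\<^sub>v x)" by auto
  also have "\<dots> = cmat A *\<^sub>v ?h x + cmat E *\<^sub>v (cmat (t \<cdot>\<^sub>m R) *\<^sub>v ?h z)"
    unfolding e1 hadd[OF cs(1,2)] hw hom[OF A x] hom[OF E w] ..
  finally have c1: "complex_of_real s \<cdot>\<^sub>v ?h x = cmat A *\<^sub>v ?h x + cmat E *\<^sub>v (cmat (t \<cdot>\<^sub>m R) *\<^sub>v ?h z)" .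
  have c2: "?h z = cmat C *\<^sub>v ?h x + cmat F *\<^sub>v (cmat (t \<cdot>\<^sub>m R) *\<^sub>v ?h z)"
    unfolding hw hom[OF C x] hom[OF F w] hadd[OF cs(3,4), symmetric] using e2 by simp
  have tR: "cmat (t \<cdot>\<^sub>m R) \<in> carrier_mat q q" using R by simp
  note iff = stable[unfolded stable_for_iff[OF A E C F tR]]
  have hx: "?h x = 0\<^sub>v n" using iff c1 c2 x z s by (metis Re_complex_of_real map_carrier_vec)
  have "cmat C *\<^sub>v ?h x = 0\<^sub>v q" using C by (auto simp: hx)
  then have "?h z = cmat F *\<^sub>v (cmat (t \<cdot>\<^sub>m R) *\<^sub>v ?h z)"
    using c2 hom[OF F w] hw cs(4) by simp
  then have hz: "?h z = 0\<^sub>v q" using iff z by (metis map_carrier_vec)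
  have "x = 0\<^sub>v n" "z = 0\<^sub>v q" using hx hz x z by (auto simp: vec_eq_iff)
  then show ?thesis by (simp add: uxz zero_append_vec)
qed

text \<open>Stability makes every matrix on the path nonsingular, so \<open>Z_matrix_path\<close>
  turns a positive vector with positive image at \<open>t = 0\<close> into one at
  \<open>t = 1\<close>. Comparison with the latter by \<open>Z_matrix_nonpos\<close> bounds
  \<open>x\<close> and \<open>z\<close>.\<close>

lemma stable_family_nonpos:
  assumes A: "A \<in> carrier_mat n n" and E: "E \<in> carrier_mat n q"
    and C: "C \<in> carrier_mat q n" and F: "F \<in> carrier_mat q q" and R: "R \<in> carrier_mat q q"
    and pos: "metzler A" "nonneg_mat E" "nonneg_mat C" "nonneg_mat F" "nonneg_mat R"
    and stable: "\<And>t. 0 \<le> t \<Longrightarrow> t \<le> 1 \<Longrightarrow> stable_for A E C F (cmat (t \<cdot>\<^sub>m R))"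
    and x: "x \<in> carrier_vec n" and z: "z \<in> carrier_vec q"
    and in1: "\<And>i. i < n \<Longrightarrow> 0 \<le> (A *\<^sub>v x) $ i + (E *\<^sub>v (R *\<^sub>v z)) $ i"
    and in2: "\<And>k. k < q \<Longrightarrow> z $ k \<le> (C *\<^sub>v x) $ k + (F *\<^sub>v (R *\<^sub>v z)) $ k"
  shows "(\<forall>i<n. x $ i \<le> 0) \<and> (\<forall>k<q. z $ k \<le> 0)"
proof -
  \<comment> \<open>\<open>\<kappa>\<close> exceeds every row sum of \<open>A\<close>, strictly
    because of the summand 1; hence \<open>\<kappa> I - A\<close> maps the ones vector to a positive
    vector.\<close>
  define \<kappa> where "\<kappa> = 1 + (\<Sum>i<n. \<Sum>j<n. \<bar>A $$ (i,j)\<bar>)"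
  define M where "M t = interconnection A E C F R ((1 - t) * \<kappa>) t" for t
  have \<kappa>: "\<kappa> \<ge> 0" unfolding \<kappa>_def by (intro add_nonneg_nonneg sum_nonneg) auto
  have M: "M t \<in> carrier_mat (n + q) (n + q)" for t
    using interconnection_carrier[OF A E C F R] by (simp add: M_def)
  have dims: "dim_row A = n" "dim_col A = n" "dim_row E = n" "dim_col E = q"
    "dim_row C = q" "dim_col C = n" "dim_row F = q" "dim_col F = q" "dim_row R = q" "dim_col R = q"
    using A E C F R by auto
  have prod_nonneg: "(P * R) $$ (i,j) \<ge> 0" if "nonneg_mat P" "P \<in> carrier_mat k q" "i < k" "j < q" for P k i j
    using that pos(5) R by (auto simp: nonneg_mat_def scalar_prod_def intro!: sum_nonneg)
  have cont: "continuous_on {0..1} (\<lambda>t. M t $$ (i,j))" if "i < n + q" "j < n + q" for i j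
    using that
    by (cases "i < n"; cases "j < n")
       (auto simp: M_def interconnection_def dims simp del: index_mult_mat(1) intro!: continuous_intros)
  have Z: "M t $$ (i,j) \<le> 0" if t: "t \<in> {0..1}" and ij: "i < n + q" "j < n + q" "i \<noteq> j" for t i j
  proof -
    have 1: "A $$ (i,j) \<ge> 0" if "i < n" "j < n" using that ij pos(1) by (simp add: metzler_def dims)
    have 2: "t * (E * R) $$ (i,j-n) \<ge> 0" if "i < n" "\<not> j < n"
      using that ij t prod_nonneg[OF pos(2) E] by simp
    have 3: "C $$ (i-n,j) \<ge> 0" if "\<not> i < n" "j < n" using that ij pos(3) by (simp add: nonneg_mat_def dims)
    have 4: "t * (F * R) $$ (i-n,j-n) \<ge> 0" if "\<not> i < n" "\<not> j < n"
      using that ij t prod_nonneg[OF pos(4) F] by simp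
    show ?thesis
      using ij 1 2 3 4
      by (cases "i < n"; cases "j < n")
         (auto simp: M_def interconnection_def dims simp del: index_mult_mat(1))
  qed
  have inj: "u = 0\<^sub>v (n + q)"
    if "t \<in> {0..1}" "u \<in> carrier_vec (n + q)" "M t *\<^sub>v u = 0\<^sub>v (n + q)" for t u
    using interconnection_nonsingular[OF A E C F R stable[of t], of "(1 - t) * \<kappa>" u] that \<kappa>
    by (simp add: M_def)
  define e where "e = vec n (\<lambda>_. 1 :: real)"
  \<comment> \<open>At \<open>t = 0\<close> the terms \<open>E R\<close> and \<open>F R\<close> are
    switched off and the lower rows send \<open>(e, f)\<close> to \<open>f - C e\<close>, which this
    choice makes the ones vector.\<close>
  define f where "f = vec q (\<lambda>k. 1 + (C *\<^sub>v e) $ k)"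
  have e: "e \<in> carrier_vec n" and f: "f \<in> carrier_vec q" by (simp_all add: e_def f_def)
  have Ce: "(C *\<^sub>v e) $ k \<ge> 0" if "k < q" for k
    unfolding mult_mat_vec_sum[OF C e that]
    using that pos(3) by (intro sum_nonneg) (simp add: nonneg_mat_def dims e_def)
  have Ae: "(A *\<^sub>v e) $ i < \<kappa>" if i: "i < n" for i
  proof -
    have "(A *\<^sub>v e) $ i \<le> (\<Sum>j<n. \<bar>A $$ (i,j)\<bar>)"
      unfolding mult_mat_vec_sum[OF A e i] by (intro sum_mono) (simp add: e_def)
    also have "\<dots> \<le> (\<Sum>i<n. \<Sum>j<n. \<bar>A $$ (i,j)\<bar>)"
      using i by (intro member_le_sum[of i _ "\<lambda>i. \<Sum>j<n. \<bar>A $$ (i,j)\<bar>"]) (auto intro: sum_nonneg)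
    finally show ?thesis by (simp add: \<kappa>_def)
  qed
  obtain y where y: "y \<in> carrier_vec (n + q)" "\<And>i. i < n + q \<Longrightarrow> y $ i > 0"
    "\<And>i. i < n + q \<Longrightarrow> (M 1 *\<^sub>v y) $ i > 0"
  proof (rule Z_matrix_path[of M "n + q" "e @\<^sub>v f"])
    show "e @\<^sub>v f \<in> carrier_vec (n + q)" using e f by simp
    show "(e @\<^sub>v f) $ i > 0" if "i < n + q" for i
    proof (cases "i < n")
      case True
      then show ?thesis using that by (simp add: e_def f_def)
    next
      case False
      then show ?thesis using that Ce[of "i - n"] by (simp add: e_def f_def add_pos_nonneg del: index_mult_mat_vec)
    qed
    show "(M 0 *\<^sub>v (e @\<^sub>v f)) $ i > 0" if "i < n + q" for i
    proof (cases "i < n")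
      case True
      then show ?thesis using Ae[of i] that dims
        unfolding M_def interconnection_mult[OF A E C F R e f]
        by (simp add: e_def f_def del: index_mult_mat_vec)
    next
      case False
      then show ?thesis using that dims
        unfolding M_def interconnection_mult[OF A E C F R e f]
        by (simp add: e_def f_def del: index_mult_mat_vec)
    qed
  qed (use M cont Z inj in auto)
  have xz: "x @\<^sub>v z \<in> carrier_vec (n + q)" using x z by simp
  \<comment> \<open>At \<open>t = 1\<close> the shift \<open>s\<close> is 0, so \<open>in1\<close>
    and \<open>in2\<close> say exactly that the image is nonpositive.\<close>
  have "(M 1 *\<^sub>v (x @\<^sub>v z)) $ i \<le> 0" if i: "i < n + q" for i
  proof (cases "i < n")
    case True
    then show ?thesis using in1[OF True] x z dims
      unfolding M_def interconnection_mult[OF A E C F R x z] by (simp del: index_mult_mat_vec)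
  next
    case False
    then have k: "i - n < q" using i by simp
    show ?thesis using False i in2[OF k] x z dims
      unfolding M_def interconnection_mult[OF A E C F R x z] by (simp del: index_mult_mat_vec)
  qed
  then have le: "(x @\<^sub>v z) $ i \<le> 0" if "i < n + q" for i
    using Z_matrix_nonpos[OF M y(1) xz Z[of 1] y(2,3) _ that] by simp
  have "x $ i \<le> 0" if "i < n" for i using le[of i] that x z by simp
  moreover have "z $ k \<le> 0" if "k < q" for k using le[of "n + k"] that x z by simp
  ultimately show ?thesis by blast
qed

theorem theorem1:
  fixes A E C F :: "real mat" and n :: nat and qs :: "nat list"
  assumes "A \<in> carrier_mat n n" "E \<in> carrier_mat n (sum_list qs)"
    "C \<in> carrier_mat (sum_list qs) n" "F \<in> carrier_mat (sum_list qs) (sum_list qs)"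
    "\<forall>i < length qs. qs ! i > 0"
    "metzler A" "nonneg_mat E" "nonneg_mat C" "nonneg_mat F"
  shows "(\<forall>\<Delta> \<in> Delta1 qs. stable_for A E C F \<Delta>) \<longleftrightarrow>
    (\<exists>lam D. lam \<in> carrier_vec n \<and> (\<forall>i < n. lam $ i > 0) \<and> D \<in> DDelta qs \<and>
       (\<forall>j < n + sum_list qs.
          (transpose_mat (four_block_mat A E C (F - 1\<^sub>m (sum_list qs)))
             *\<^sub>v (lam @\<^sub>v (D *\<^sub>v ones_vec (sum_list qs)))) $ j < 0))"
    (is "?stable \<longleftrightarrow> ?lmi")
proof -
  let ?q = "sum_list qs"
  note A = assms(1) and E = assms(2) and C = assms(3) and F = assms(4) and qs = assms(5)
    and pos = assms(6-9)
  have ?stable if ?lmi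
  proof -
    from that obtain lam d where lam: "lam \<in> carrier_vec n" "\<And>i. i < n \<Longrightarrow> lam $ i > 0"
      and d: "\<forall>i<length qs. d i > 0"
      and lmi: "\<forall>j < n + ?q. (transpose_mat (four_block_mat A E C (F - 1\<^sub>m ?q)) *\<^sub>v
        (lam @\<^sub>v (mat ?q ?q (\<lambda>(j,k). if j = k then d (blk_of qs j) else 0) *\<^sub>v ones_vec ?q))) $ j < 0"
      unfolding DDelta_def by blast
    note neg = lmi[unfolded weighted_inequality_iff[OF A E C F lam(1), of "\<lambda>k. d (blk_of qs k)"]]
    show ?stable
    proof
      fix \<Delta> assume "\<Delta> \<in> Delta1 qs"
      then have \<Delta>: "\<Delta> \<in> carrier_mat ?q ?q" and contr: "\<And>i z. i < length qs \<Longrightarrow> z \<in> carrier_vec ?q \<Longrightarrow>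
          (\<Sum>k\<in>blk qs i. cmod ((\<Delta> *\<^sub>v z) $ k)) \<le> (\<Sum>k\<in>blk qs i. cmod (z $ k))"
        unfolding Delta1_iff[OF qs] by blast+
      show "stable_for A E C F \<Delta>"
      proof (rule weighted_inequality_imp_stable[OF A E C F \<Delta> pos, of "\<lambda>i. lam $ i" "\<lambda>k. d (blk_of qs k)"])
        fix z :: "complex vec" assume z: "z \<in> carrier_vec ?q"
        \<comment> \<open>The weight is constant on each block, so the sum regroups and the
          contraction on block \<open>i\<close> is merely scaled by \<open>d i\<close>.\<close>
        have group: "(\<Sum>k<?q. d (blk_of qs k) * h k) = (\<Sum>i<length qs. d i * (\<Sum>k\<in>blk qs i. h k))" for h
          unfolding sum_over_blks sum_distrib_left by (intro sum.cong refl) (simp add: blk_def)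
        show "(\<Sum>k<?q. d (blk_of qs k) * cmod ((\<Delta> *\<^sub>v z) $ k)) \<le> (\<Sum>k<?q. d (blk_of qs k) * cmod (z $ k))"
          unfolding group
        proof (rule sum_mono)
          fix i assume "i \<in> {..<length qs}"
          then show "d i * (\<Sum>k\<in>blk qs i. cmod ((\<Delta> *\<^sub>v z) $ k)) \<le> d i * (\<Sum>k\<in>blk qs i. cmod (z $ k))"
            using contr[OF _ z, of i] d by (simp add: less_imp_le mult_left_mono)
        qed
      qed (use lam d neg blk_of_bounds(1) in auto)
    qed
  qed
  moreover have ?lmi if st: ?stable
  proof -
    have "\<exists>lam d. (\<forall>i<n. lam i > 0) \<and> (\<forall>b<length qs. d b > 0) \<and>
      (\<forall>j<n. (\<Sum>i<n. lam i * A $$ (i,j)) + (\<Sum>k<?q. d (blk_of qs k) * C $$ (k,j)) < 0) \<and>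
      (\<forall>l<?q. (\<Sum>i<n. lam i * E $$ (i,l)) + (\<Sum>k<?q. d (blk_of qs k) * F $$ (k,l)) - d (blk_of qs l) < 0)"
    proof (rule ccontr)
      assume no: "\<not> ?thesis"
      obtain x w where x: "\<And>i. i < n \<Longrightarrow> x i \<ge> 0" and w: "\<And>k. k < ?q \<Longrightarrow> w k \<ge> 0"
        and nz: "(\<exists>i<n. x i > 0) \<or> (\<exists>k<?q. w k > 0)"
        and in1: "\<And>i. i < n \<Longrightarrow> 0 \<le> (\<Sum>j<n. A $$ (i,j) * x j) + (\<Sum>l<?q. E $$ (i,l) * w l)"
        and in2: "\<And>b. b < length qs \<Longrightarrow> (\<Sum>k\<in>blk qs b. w k) \<le>
          (\<Sum>k\<in>blk qs b. (\<Sum>j<n. C $$ (k,j) * x j) + (\<Sum>l<?q. F $$ (k,l) * w l))"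
        by (rule weighted_inequality_alternative[of n qs "\<lambda>i j. A $$ (i,j)" "\<lambda>k j. C $$ (k,j)"
            "\<lambda>i l. E $$ (i,l)" "\<lambda>k l. F $$ (k,l)", OF no]) (rule that; assumption)
      define z where "z k = (\<Sum>j<n. C $$ (k,j) * x j) + (\<Sum>l<?q. F $$ (k,l) * w l)" for k
      define \<zeta> where "\<zeta> b = (\<Sum>k\<in>blk qs b. z k)" for b
      define R where "R = block_rank_one qs w \<zeta>"
      define xv where "xv = vec n x"
      define zv where "zv = vec ?q z"
      have carrier: "R \<in> carrier_mat ?q ?q" "xv \<in> carrier_vec n" "zv \<in> carrier_vec ?q"
        by (simp_all add: R_def xv_def zv_def)
      have le: "(\<Sum>k\<in>blk qs b. w k) \<le> \<zeta> b" if "b < length qs" for b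
        using in2[OF that] by (simp add: \<zeta>_def z_def)
      have w_blk: "w k \<ge> 0" if "k \<in> blk qs b" for k b using w that by (simp add: blk_def)
      \<comment> \<open>Where \<open>\<zeta>\<close> is 0 this forces \<open>w\<close> to vanish on
        the block, so the division by zero inside \<open>R\<close> still leaves
        \<open>R z = w\<close>.\<close>
      have w_le: "w k \<le> \<zeta> (blk_of qs k)" if k: "k < ?q" for k
      proof -
        have "w k \<le> (\<Sum>k\<in>blk qs (blk_of qs k). w k)"
          using k w_blk by (intro member_le_sum) (auto simp: blk_def)
        then show ?thesis using le[OF blk_of_bounds(1)[OF k]] by simp
      qed
      have Rz: "R *\<^sub>v zv = vec ?q w"
      proof (rule eq_vecI)
        fix k assume "k < dim_vec (vec ?q w)"
        then have k: "k < ?q" by simp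
        have "(R *\<^sub>v zv) $ k = (\<Sum>l<?q. R $$ (k,l) * z l)"
          unfolding mult_mat_vec_sum[OF carrier(1,3) k] by (simp add: zv_def)
        also have "\<dots> = w k / \<zeta> (blk_of qs k) * \<zeta> (blk_of qs k)"
          using block_rank_one_mult[OF k, of w \<zeta> z] by (simp add: R_def \<zeta>_def)
        also have "\<dots> = w k" using w_le[OF k] w[OF k] by (cases "\<zeta> (blk_of qs k) = 0") auto
        finally show "(R *\<^sub>v zv) $ k = vec ?q w $ k" using k by simp
      qed (use carrier in simp)
      have "nonneg_mat R"
        using w w_le by (force simp: nonneg_mat_def R_def block_rank_one_def intro!: divide_nonneg_nonneg)
      \<comment> \<open>Stability is used for the whole segment of matrices \<open>t R\<close>, all
        of which lie in \<open>Delta1 qs\<close>.\<close>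
      moreover have "stable_for A E C F (cmat (t \<cdot>\<^sub>m R))" if "0 \<le> t" "t \<le> 1" for t
        using st block_rank_one_in_Delta1[OF qs w le that] by (simp add: R_def)
      moreover have "0 \<le> (A *\<^sub>v xv) $ i + (E *\<^sub>v (R *\<^sub>v zv)) $ i" if "i < n" for i
        unfolding Rz mult_mat_vec_sum[OF A carrier(2) that] mult_mat_vec_sum[OF E vec_carrier that]
        using in1[OF that] by (simp add: xv_def)
      moreover have "zv $ k \<le> (C *\<^sub>v xv) $ k + (F *\<^sub>v (R *\<^sub>v zv)) $ k" if "k < ?q" for k
        unfolding Rz mult_mat_vec_sum[OF C carrier(2) that] mult_mat_vec_sum[OF F vec_carrier that]
        using that by (simp add: xv_def zv_def z_def)
      ultimately have np: "(\<forall>i<n. xv $ i \<le> 0) \<and> (\<forall>k<?q. zv $ k \<le> 0)"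
        using stable_family_nonpos[OF A E C F carrier(1) pos _ _ carrier(2,3)] by blast
      \<comment> \<open>From \<open>z \<le> 0\<close> the block sums \<open>\<zeta>\<close> are
        nonpositive, and they dominate \<open>w\<close>; together with \<open>x \<le> 0\<close> this
        contradicts \<open>nz\<close>.\<close>
      then have "\<zeta> b \<le> 0" for b
        unfolding \<zeta>_def by (intro sum_nonpos) (auto simp: blk_def zv_def)
      then have "w k \<le> 0" if "k < ?q" for k using w_le[OF that] by (meson order_trans)
      moreover have "x i \<le> 0" if "i < n" for i using np that by (simp add: xv_def)
      ultimately show False using nz by (meson not_le)
    qed
    then obtain lam d where lam: "\<forall>i<n. lam i > 0" and d: "\<forall>b<length qs. d b > 0"
      and neg: "\<forall>j<n. (\<Sum>i<n. lam i * A $$ (i,j)) + (\<Sum>k<?q. d (blk_of qs k) * C $$ (k,j)) < 0"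
       "\<forall>l<?q. (\<Sum>i<n. lam i * E $$ (i,l)) + (\<Sum>k<?q. d (blk_of qs k) * F $$ (k,l)) - d (blk_of qs l) < 0"
      by blast
    let ?D = "mat ?q ?q (\<lambda>(j,k). if j = k then d (blk_of qs j) else 0)"
    have "?D \<in> DDelta qs" using d unfolding DDelta_def by blast
    moreover have "\<forall>j < n + ?q. (transpose_mat (four_block_mat A E C (F - 1\<^sub>m ?q)) *\<^sub>v
        (vec n lam @\<^sub>v (?D *\<^sub>v ones_vec ?q))) $ j < 0"
      using neg by (subst weighted_inequality_iff[OF A E C F, of "vec n lam" "\<lambda>k. d (blk_of qs k)"]) auto
    ultimately show ?lmi using lam by (intro exI[of _ "vec n lam"] exI[of _ ?D]) auto
  qed
  ultimately show ?thesis by blast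
qed

end
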